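(* Let $T>0$ and let $(c^k,v^k)\in\vec{\mathrm{CE}}_T(c^k(0),c^k(T))$, $k\in\mathbb N$, satisfy $\sup_k\int_0^T\vec{\mathcal A}(c^k(t),v^k(t))dt\le C<\infty$. Then there exist a subsequence and a limit $(c,v)$ such that $c^k\to c$ uniformly on $[0,T]$ along the subsequence, $(c,v)\in\vec{\mathrm{CE}}_T(c(0),c(T))$, and $$\liminf_{k\to\infty}\int_0^T\vec{\mathcal A}(c^k(t),v^k(t))dt\ge\int_0^T\vec{\mathcal A}(c(t),v(t))dt.$$
   Context: $\mathcal X=\{1,\dots,d\}$ finite, $\mathcal P(\mathcal X)\subset\mathbb R^{\mathcal X}$. $\{Q(\mu)\}$ rate matrices ($Q_{xy}\ge0$, $x\ne y$), each irreducible and reversible w.r.t. a Gibbs measure $\pi(\mu)$, with $\mu\mapsto Q_{xy}(\mu)$ Lipschitz on $\mathcal P(\mathcal X)$. $\Lambda(s,t)=\int_0^1s^\alpha t^{1-\alpha}d\alpha$, $w_{xy}(\mu)=\Lambda(\mu_xQ_{xy}(\mu),\mu_yQ_{yx}(\mu))$. $(\delta v)_x=\frac12\sum_y(v_{xy}-v_{yx})$. $(c,v)\in\vec{\mathrm{CE}}_T(\mu,\nu)$: $c:[0,T]\to\mathcal P(\mathcal X)$ continuous, $c(0)=\mu$, $c(T)=\nu$, $v:[0,T]\to\mathbb R^{\mathcal X\times\mathcal X}$ measurable and integrable, $\int_0^T[\dot\varphi c_x-\varphi(\delta v)_x]dt=0$ for all $\varphi\in C^1_c((0,T))$, $x\in\mathcal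 X$. $\alpha(v,w)=v^2/w$ if $w>0$, $0$ if $v=w=0$, $+\infty$ otherwise; $\vec{\mathcal A}(\mu,v)=\frac12\sum_{x,y}\alpha(v_{xy},w_{xy}(\mu))$. *)

theory Defs
  imports "HOL-Analysis.Analysis"
begin

text \<open>State space: a finite type 'x (playing the role of {1,...,d}).
  Measures on 'x are vectors in real^'x.\<close>

definition Prob :: "(real^'x::finite) set" where
  "Prob = {\<mu>. (\<forall>x. 0 \<le> \<mu> $ x) \<and> (\<Sum>x\<in>UNIV. \<mu> $ x) = 1}"

definition rate_matrix :: "real^'x^'x \<Rightarrow> bool" where
  "rate_matrix Q \<longleftrightarrow> (\<forall>x y. x \<noteq> y \<longrightarrow> 0 \<le> Q $ x $ y)
     \<and> (\<forall>x. Q $ x $ x = - (\<Sum>y\<in>UNIV - {x}. Q $ x $ y))"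

definition irreducible_rm :: "real^'x^'x \<Rightarrow> bool" where
  "irreducible_rm Q \<longleftrightarrow> (\<forall>x y. (x, y) \<in> {(a, b). a \<noteq> b \<and> 0 < Q $ a $ b}\<^sup>*)"

definition reversible_wrt :: "real^'x^'x \<Rightarrow> real^'x \<Rightarrow> bool" where
  "reversible_wrt Q \<pi> \<longleftrightarrow> (\<forall>x y. \<pi> $ x * Q $ x $ y = \<pi> $ y * Q $ y $ x)"

text \<open>Standing assumptions on the family Q(\<mu>), \<mu> \<in> P(X).  The Gibbs measure
  \<pi>(\<mu>) is a strictly positive probability vector.\<close>
definition standing :: "(real^'x \<Rightarrow> real^'x^'x) \<Rightarrow> bool" where
  "standing Q \<longleftrightarrow>
     (\<forall>\<mu>\<in>Prob. rate_matrix (Q \<mu>) \<and> irreducible_rm (Q \<mu>) \<and>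
        (\<exists>\<pi>\<in>Prob. (\<forall>x. 0 < \<pi> $ x) \<and> reversible_wrt (Q \<mu>) \<pi>)) \<and>
     (\<forall>x y. \<exists>L. L-lipschitz_on Prob (\<lambda>\<mu>. Q \<mu> $ x $ y))"

text \<open>Logarithmic mean \<Lambda>(s,t) = \<integral>_0^1 s^a t^(1-a) da.\<close>
definition LogMean :: "real \<Rightarrow> real \<Rightarrow> real" where
  "LogMean s t = integral {0..1} (\<lambda>a. s powr a * t powr (1 - a))"

definition wgt :: "(real^'x \<Rightarrow> real^'x^'x) \<Rightarrow> real^'x \<Rightarrow> 'x \<Rightarrow> 'x \<Rightarrow> real" where
  "wgt Q \<mu> x y = LogMean (\<mu> $ x * Q \<mu> $ x $ y) (\<mu> $ y * Q \<mu> $ y $ x)"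

definition divg :: "real^'x^'x \<Rightarrow> 'x \<Rightarrow> real" where
  "divg v x = (1/2) * (\<Sum>y\<in>UNIV. v $ x $ y - v $ y $ x)"

definition alpha :: "real \<Rightarrow> real \<Rightarrow> ennreal" where
  "alpha v w = (if 0 < w then ennreal (v\<^sup>2 / w)
                else if v = 0 \<and> w = 0 then 0 else \<infinity>)"

text \<open>Action; the sum is over off-diagonal pairs (diagonal terms are not meaningful).\<close>
definition Action :: "(real^'x \<Rightarrow> real^'x^'x) \<Rightarrow> real^'x \<Rightarrow> real^'x^'x \<Rightarrow> ennreal" where
  "Action Q \<mu> v = ennreal (1/2) *
     (\<Sum>(x, y)\<in>{(a, b). a \<noteq> b}. alpha (v $ x $ y) (wgt Q \<mu> x y))"

definition ActionInt :: "(real^'x \<Rightarrow> real^'x^'x) \<Rightarrow> real \<Rightarrow> (real \<Rightarrow> real^'x)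
     \<Rightarrow> (real \<Rightarrow> real^'x^'x) \<Rightarrow> ennreal" where
  "ActionInt Q T c v = (\<integral>\<^sup>+ t\<in>{0..T}. Action Q (c t) (v t) \<partial>lborel)"

text \<open>Test functions C^1_c((0,T)).\<close>
definition test_fun :: "real \<Rightarrow> (real \<Rightarrow> real) \<Rightarrow> bool" where
  "test_fun T \<phi> \<longleftrightarrow> \<phi> C1_differentiable_on UNIV \<and>
     (\<exists>a b. 0 < a \<and> b < T \<and> (\<forall>t. t \<notin> {a..b} \<longrightarrow> \<phi> t = 0))"

text \<open>Continuity equation (c,v) \<in> CE_T(\<mu>,\<nu>).\<close>
definition CE :: "real \<Rightarrow> real^'x \<Rightarrow> real^'x \<Rightarrow> (real \<Rightarrow> real^'x)
     \<Rightarrow> (real \<Rightarrow> real^'x^'x) \<Rightarrow> bool" where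
  "CE T \<mu> \<nu> c v \<longleftrightarrow>
     continuous_on {0..T} c \<and> (\<forall>t\<in>{0..T}. c t \<in> Prob) \<and> c 0 = \<mu> \<and> c T = \<nu> \<and>
     set_integrable lborel {0..T} v \<and>
     (\<forall>\<phi> x. test_fun T \<phi> \<longrightarrow>
        (LINT t:{0..T}|lborel. deriv \<phi> t * c t $ x - \<phi> t * divg (v t) x) = 0)"

end

theory Submission
  imports Defs "HOL-Complex_Analysis.Great_Picard"
begin

text \<open>
  The weights \<open>w\<^sub>x\<^sub>y\<close> are continuous on the compact simplex, hence bounded, so the action bound is
  an \<open>L\<^sup>2\<close> bound on the off-diagonal fluxes. Testing the continuity equation with smoothed
  indicators of \<open>[s, t]\<close> turns it into equicontinuity of the curves, and Arzela-Ascoli gives the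
  uniform limit \<open>c\<close>. After passing to a further subsequence along which the actions converge,
  averages of the tails of \<open>(v\<^sup>k, c\<^sup>k, w(c\<^sup>k))\<close> converge in \<open>L\<^sup>1\<close> and almost everywhere to some
  \<open>(v, c, w(c))\<close>. The weak continuity equation is linear and survives averaging and the limit. Since
  \<open>\<alpha>(v, w)\<close> is the supremum over \<open>p\<close> of \<open>2pv - p\<^sup>2w\<close>, it is jointly convex and lower
  semicontinuous, so Fatou's lemma bounds the action of the limit by the limit of the actions.
\<close>

subsection \<open>Convergent averages of bounded sequences\<close>

text \<open>The action depends on the curve through the nonlinear weights, so averaging only the
  pairs \<open>(c, v)\<close> would ruin the bound: the weight of an averaged curve is not the
  average of the weights. Hence the weights are carried along as independent variables, in which the
  density is jointly convex. Their averages still have the right limit, because uniform convergence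
  of the curves makes the weights converge pointwise and averages of tails inherit such a limit.
  Only the flux has no pointwise limit before averaging.

  The weights may vanish on the boundary of the simplex, where \<alpha> is infinite for nonzero
  flux. The representation as a supremum treats this degenerate case together with the regular one.

  Averages are built by repeated midpoints, which gives the dyadic convex combinations. This
  suffices: the parallelogram law needs only midpoints, and each property of the averages (lying in
  a ball, the \<open>L^2\<close> bound, the weak equation, the action bound) is an induction with a
  single midpoint step.\<close>

inductive_set mid_hull :: "(nat \<Rightarrow> 'a \<Rightarrow> 'b::real_vector) \<Rightarrow> nat \<Rightarrow> ('a \<Rightarrow> 'b) set"
  for f :: "nat \<Rightarrow> 'a \<Rightarrow> 'b" and n :: nat
  where
    base: "n \<le> k \<Longrightarrow> f k \<in> mid_hull f n"
  | mid: "g \<in> mid_hull f n \<Longrightarrow> h \<in> mid_hull f n \<Longrightarrow>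
      (\<lambda>x. (1/2) *\<^sub>R (g x + h x)) \<in> mid_hull f n"

lemma mid_hull_antimono:
  assumes "g \<in> mid_hull f n" "m \<le> n"
  shows "g \<in> mid_hull f m"
  using assms by (induction rule: mid_hull.induct) (auto intro: mid_hull.intros)

lemma midpoint_in_convex:
  fixes a b :: "'a::real_vector"
  assumes "convex S" "a \<in> S" "b \<in> S"
  shows "(1/2) *\<^sub>R (a + b) \<in> S"
  using convexD[OF assms, of "1/2" "1/2"] by (simp add: scaleR_add_right)

text \<open>Balls are convex, so once the tail of the sequence lies in a ball around the limit,
  every average of that tail does too. The linear map \<open>L\<close> allows the use on part of a
  tuple whose other entries need not converge; it is applied with \<open>snd\<close>.\<close>

lemma mid_hull_tendsto:
  fixes f :: "nat \<Rightarrow> 'a \<Rightarrow> 'b::real_normed_vector" and L :: "'b \<Rightarrow> 'c::real_normed_vector"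
  assumes lin: "linear L"
    and lim: "(\<lambda>k. L (f k x)) \<longlonglongrightarrow> l"
    and u: "\<And>i. u i \<in> mid_hull f i"
  shows "(\<lambda>i. L (u i x)) \<longlonglongrightarrow> l"
proof (rule LIMSEQ_I)
  fix e :: real assume "0 < e"
  then obtain N where N: "\<And>k. k \<ge> N \<Longrightarrow> L (f k x) \<in> ball l e"
    using LIMSEQ_D[OF lim \<open>0 < e\<close>] by (auto simp: dist_norm norm_minus_commute)
  have "L (g x) \<in> ball l e" if "g \<in> mid_hull f i" "N \<le> i" for g i
    using that
  proof (induction rule: mid_hull.induct)
    case (mid g h)
    then show ?case
      using midpoint_in_convex[OF convex_ball, of "L (g x)" l e "L (h x)"]
      by (simp only: linear_cmul[OF lin] linear_add[OF lin])
  qed (use N in auto)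
  then have "norm (L (u i x) - l) < e" if "N \<le> i" for i
    using u[of i] that by (auto simp: dist_norm norm_minus_commute)
  then show "\<exists>N. \<forall>i\<ge>N. norm (L (u i x) - l) < e" by blast
qed

lemma parallelogram_midpoint:
  fixes a b :: "'a::real_inner"
  shows "(norm (a - b))\<^sup>2 = 2 * (norm a)\<^sup>2 + 2 * (norm b)\<^sup>2 - 4 * (norm ((1/2) *\<^sub>R (a + b)))\<^sup>2"
  by (simp add: power2_norm_eq_inner inner_diff inner_add inner_commute power_mult_distrib algebra_simps)

lemma (in finite_measure) integrable_of_square_integrable:
  fixes f :: "'a \<Rightarrow> 'b::{banach, second_countable_topology}"
  assumes "f \<in> borel_measurable M" "integrable M (\<lambda>x. (norm (f x))\<^sup>2)"
  shows "integrable M f"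
proof (rule Bochner_Integration.integrable_bound)
  show "integrable M (\<lambda>x. 1 + (norm (f x))\<^sup>2)"
    using assms by simp
  have "r \<le> 1 + r\<^sup>2" for r :: real
    using zero_le_power2[of "r - 1/2"] by (simp add: power2_eq_square algebra_simps)
  then show "AE x in M. norm (f x) \<le> norm (1 + (norm (f x))\<^sup>2)"
    by simp
qed fact

lemma square_integrable_midpoint:
  fixes f g :: "'a \<Rightarrow> 'b::euclidean_space"
  assumes [measurable]: "f \<in> borel_measurable M" "g \<in> borel_measurable M"
    and int: "integrable M (\<lambda>x. (norm (f x))\<^sup>2)" "integrable M (\<lambda>x. (norm (g x))\<^sup>2)"
  shows "integrable M (\<lambda>x. (norm ((1/2) *\<^sub>R (f x + g x)))\<^sup>2)"
    and "integrable M (\<lambda>x. (norm (f x - g x))\<^sup>2)"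
    and "(\<integral>x. (norm (f x - g x))\<^sup>2 \<partial>M) = 2 * (\<integral>x. (norm (f x))\<^sup>2 \<partial>M)
      + 2 * (\<integral>x. (norm (g x))\<^sup>2 \<partial>M) - 4 * (\<integral>x. (norm ((1/2) *\<^sub>R (f x + g x)))\<^sup>2 \<partial>M)"
    and "(\<integral>x. (norm ((1/2) *\<^sub>R (f x + g x)))\<^sup>2 \<partial>M)
      \<le> ((\<integral>x. (norm (f x))\<^sup>2 \<partial>M) + (\<integral>x. (norm (g x))\<^sup>2 \<partial>M)) / 2"
proof -
  have le: "(norm ((1/2) *\<^sub>R (f x + g x)))\<^sup>2 \<le> ((norm (f x))\<^sup>2 + (norm (g x))\<^sup>2) / 2" for x
    using parallelogram_midpoint[of "f x" "g x"] zero_le_power2[of "norm (f x - g x)"] by argo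
  have int': "integrable M (\<lambda>x. ((norm (f x))\<^sup>2 + (norm (g x))\<^sup>2) / 2)"
    using int by auto
  show 1: "integrable M (\<lambda>x. (norm ((1/2) *\<^sub>R (f x + g x)))\<^sup>2)"
    by (rule Bochner_Integration.integrable_bound[OF int']) (use le in \<open>auto simp del: norm_scaleR\<close>)
  show "integrable M (\<lambda>x. (norm (f x - g x))\<^sup>2)"
    unfolding parallelogram_midpoint
    by (intro Bochner_Integration.integrable_diff Bochner_Integration.integrable_add
        integrable_mult_right int 1)
  show "(\<integral>x. (norm (f x - g x))\<^sup>2 \<partial>M) = 2 * (\<integral>x. (norm (f x))\<^sup>2 \<partial>M)
      + 2 * (\<integral>x. (norm (g x))\<^sup>2 \<partial>M) - 4 * (\<integral>x. (norm ((1/2) *\<^sub>R (f x + g x)))\<^sup>2 \<partial>M)"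
    unfolding parallelogram_midpoint
    by (subst Bochner_Integration.integral_diff Bochner_Integration.integral_add;
        use int 1 in \<open>simp del: norm_scaleR\<close>)+
  show "(\<integral>x. (norm ((1/2) *\<^sub>R (f x + g x)))\<^sup>2 \<partial>M)
      \<le> ((\<integral>x. (norm (f x))\<^sup>2 \<partial>M) + (\<integral>x. (norm (g x))\<^sup>2 \<partial>M)) / 2"
    using integral_mono[OF 1 int'] le int by simp
qed

text \<open>Balls of \<open>L^2\<close> centred at 0 are convex, so averages inherit the bound
  \<open>K\<close>.\<close>

lemma mid_hull_square_integrable:
  fixes f :: "nat \<Rightarrow> 'a \<Rightarrow> 'b::euclidean_space"
  assumes meas: "\<And>k. f k \<in> borel_measurable M"
    and sq: "\<And>k. integrable M (\<lambda>x. (norm (f k x))\<^sup>2)"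
    and bound: "\<And>k. (\<integral>x. (norm (f k x))\<^sup>2 \<partial>M) \<le> K"
    and "g \<in> mid_hull f n"
  shows "g \<in> borel_measurable M \<and> integrable M (\<lambda>x. (norm (g x))\<^sup>2) \<and>
    (\<integral>x. (norm (g x))\<^sup>2 \<partial>M) \<le> K"
  using assms(4)
proof (induction rule: mid_hull.induct)
  case (base k)
  then show ?case using meas sq bound by blast
next
  case (mid g h)
  then have [measurable]: "g \<in> borel_measurable M" "h \<in> borel_measurable M" by auto
  have "(\<lambda>x. (1/2) *\<^sub>R (g x + h x)) \<in> borel_measurable M" by measurable
  moreover note square_integrable_midpoint(1,4)[of g M h]
  ultimately show ?case using mid.IH by (auto simp del: norm_scaleR)
qed

text \<open>On a finite measure, increments whose squared norms have integrals of order
  \<open>4^-i\<close> have \<open>L^1\<close> norms of order \<open>2^-i\<close>. These are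
  summable, so the telescoping series converges absolutely almost everywhere, and the series of the
  norms of the increments dominates every error \<open>u n - g\<close>.\<close>

lemma (in finite_measure) L1_AE_limit_of_fast_L2_Cauchy:
  fixes u :: "nat \<Rightarrow> 'a \<Rightarrow> 'b::euclidean_space"
  assumes u: "\<And>i. integrable M (u i)"
    and sq: "\<And>i. integrable M (\<lambda>x. (norm (u (Suc i) x - u i x))\<^sup>2)"
    and fast: "\<And>i. (\<integral>x. (norm (u (Suc i) x - u i x))\<^sup>2 \<partial>M) \<le> B * (1/4) ^ i"
  obtains g where "integrable M g" "AE x in M. (\<lambda>i. u i x) \<longlonglongrightarrow> g x"
    "(\<lambda>i. \<integral>x. norm (u i x - g x) \<partial>M) \<longlonglongrightarrow> 0"
proof -
  define d where "d i x = u (Suc i) x - u i x" for i x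
  have d: "integrable M (d i)" for i
    unfolding d_def using u by auto
  have [measurable]: "d i \<in> borel_measurable M" "u i \<in> borel_measurable M" for i
    using d u by auto
  define K where "K = (B + measure M (space M)) / 2"
  have dle: "(\<integral>x. norm (d i x) \<partial>M) \<le> K * (1/2) ^ i" for i
  proof -
    \<comment> \<open>Young's inequality with weight \<open>2^i\<close>: it brings the squared
      increment, of order \<open>4^-i\<close>, and the constant term to the same order
      \<open>2^-i\<close>.\<close>
    have young: "r \<le> (2 ^ i * r\<^sup>2 + (1/2) ^ i) / 2" for r :: real
    proof -
      have "0 \<le> (2 ^ i * r - 1)\<^sup>2 * (1/2) ^ i" by simp
      also have "\<dots> = 2 ^ i * r\<^sup>2 + (1/2) ^ i - 2 * r"
        by (simp add: power2_eq_square field_simps power_divide)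
      finally show ?thesis by simp
    qed
    have "(\<integral>x. norm (d i x) \<partial>M) \<le> (\<integral>x. (2 ^ i * (norm (d i x))\<^sup>2 + (1/2) ^ i) / 2 \<partial>M)"
    proof (rule integral_mono)
      show "integrable M (\<lambda>x. (2 ^ i * (norm (d i x))\<^sup>2 + (1/2) ^ i) / 2)"
        using sq[of i] by (simp add: d_def)
    qed (use d young in auto)
    also have "\<dots> = (2 ^ i * (\<integral>x. (norm (d i x))\<^sup>2 \<partial>M) + (1/2) ^ i * measure M (space M)) / 2"
      using sq by (subst integral_divide_zero, subst Bochner_Integration.integral_add) (auto simp: d_def)
    also have "\<dots> \<le> (2 ^ i * (B * (1/4) ^ i) + (1/2) ^ i * measure M (space M)) / 2"
      using fast[of i] by (intro divide_right_mono add_right_mono mult_left_mono) (auto simp: d_def)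
    also have "2 ^ i * (B * (1/4) ^ i) = B * (1/2) ^ i"
      by (simp add: power_divide field_simps flip: power_mult_distrib)
    finally show ?thesis by (simp add: K_def field_simps)
  qed
  have sumd: "summable (\<lambda>i. \<integral>x. norm (d i x) \<partial>M)"
    by (rule summable_comparison_test[OF _ summable_mult[OF summable_geometric[of "1/2::real"]]])
       (use dle in \<open>auto intro!: exI[of _ 0]\<close>)
  have "(\<integral>\<^sup>+x. (\<Sum>i. ennreal (norm (d i x))) \<partial>M) = (\<Sum>i. \<integral>\<^sup>+x. ennreal (norm (d i x)) \<partial>M)"
    by (rule nn_integral_suminf) simp
  also have "\<dots> = (\<Sum>i. ennreal (\<integral>x. norm (d i x) \<partial>M))"
    using d by (intro suminf_cong nn_integral_eq_integral) auto
  also have "\<dots> \<noteq> \<infinity>"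
    using sumd by (subst suminf_ennreal2) auto
  finally have "AE x in M. (\<Sum>i. ennreal (norm (d i x))) \<noteq> \<infinity>"
    by (intro nn_integral_PInf_AE) auto
  then have sumAE: "AE x in M. summable (\<lambda>i. norm (d i x))"
    by eventually_elim (auto intro: summable_suminf_not_top)
  have intsum: "integrable M (\<lambda>x. \<Sum>i. d i x)" "integrable M (\<lambda>x. \<Sum>i. norm (d i x))"
    using integrable_suminf[OF d sumAE sumd] integrable_suminf[of M "\<lambda>i x. norm (d i x)"] d sumAE sumd
    by auto
  define g where "g x = u 0 x + (\<Sum>i. d i x)" for x
  have g: "integrable M g" unfolding g_def using u intsum by auto
  then have [measurable]: "g \<in> borel_measurable M" by auto
  have tele: "u n x = u 0 x + (\<Sum>i<n. d i x)" for n x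
    unfolding d_def using sum_lessThan_telescope[of "\<lambda>i. u i x" n] by simp
  have lim: "AE x in M. (\<lambda>i. u i x) \<longlonglongrightarrow> g x"
    using sumAE
  proof eventually_elim
    case (elim x)
    then have "summable (\<lambda>i. d i x)" by (rule summable_norm_cancel)
    then have "(\<lambda>n. u 0 x + (\<Sum>i<n. d i x)) \<longlonglongrightarrow> g x"
      unfolding g_def by (intro tendsto_add tendsto_const summable_LIMSEQ)
    then show ?case by (simp only: tele[symmetric])
  qed
  have "(\<lambda>n. \<integral>x. norm (u n x - g x) \<partial>M) \<longlonglongrightarrow> (\<integral>x. 0 \<partial>M)"
  proof (rule integral_dominated_convergence)
    show "integrable M (\<lambda>x. \<Sum>i. norm (d i x))" by fact
    show "AE x in M. (\<lambda>n. norm (u n x - g x)) \<longlonglongrightarrow> 0"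
      using lim by eventually_elim (simp add: LIM_zero tendsto_norm_zero)
    show "AE x in M. norm (norm (u n x - g x)) \<le> (\<Sum>i. norm (d i x))" for n
      using sumAE
    proof eventually_elim
      case (elim x)
      then have s: "summable (\<lambda>i. d i x)" by (rule summable_norm_cancel)
      have "g x - u n x = (\<Sum>i. d (i + n) x)"
        unfolding g_def tele[of n x] using suminf_split_initial_segment[OF s, of n] by simp
      then have "norm (u n x - g x) = norm (\<Sum>i. d (i + n) x)"
        by (metis norm_minus_commute)
      also have "\<dots> \<le> (\<Sum>i. norm (d (i + n) x))"
        using elim by (intro summable_norm) (rule summable_ignore_initial_segment)
      also have "\<dots> \<le> (\<Sum>i. norm (d i x))"
        using suminf_split_initial_segment[OF elim, of n] sum_nonneg[of "{..<n}" "\<lambda>i. norm (d i x)"]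
        by simp
      finally show ?case by simp
    qed
  qed simp_all
  with that g lim show thesis by simp
qed

text \<open>A Mazur-type lemma that replaces weak \<open>L\<^sup>2\<close> compactness: by the parallelogram law, near
  minimisers of the \<open>L\<^sup>2\<close> norm over the tail hulls form a Cauchy sequence.\<close>
lemma (in finite_measure) mid_hull_L2_bounded_convergent:
  fixes f :: "nat \<Rightarrow> 'a \<Rightarrow> 'b::euclidean_space"
  assumes meas: "\<And>k. f k \<in> borel_measurable M"
    and sq: "\<And>k. integrable M (\<lambda>x. (norm (f k x))\<^sup>2)"
    and bound: "\<And>k. (\<integral>x. (norm (f k x))\<^sup>2 \<partial>M) \<le> K"
  obtains u g where "\<forall>i. u i \<in> mid_hull f i" "integrable M g"
    "AE x in M. (\<lambda>i. u i x) \<longlonglongrightarrow> g x" "(\<lambda>i. \<integral>x. norm (u i x - g x) \<partial>M) \<longlonglongrightarrow> 0"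
proof -
  define q where "q g = (\<integral>x. (norm (g x))\<^sup>2 \<partial>M)" for g :: "'a \<Rightarrow> 'b"
  define m where "m n = (INF g\<in>mid_hull f n. q g)" for n
  note hull = mid_hull_square_integrable[OF meas sq bound]
  have q0: "0 \<le> q g" for g by (simp add: q_def)
  have bdd: "bdd_below (q ` mid_hull f n)" for n
    using q0 by (auto intro!: bdd_belowI[of _ 0])
  have m_le: "m n \<le> q g" if "g \<in> mid_hull f n" for g n
    unfolding m_def by (rule cINF_lower[OF bdd that])
  have ne: "f n \<in> mid_hull f n" for n by (auto intro: mid_hull.base)
  have "incseq m"
    unfolding m_def incseq_def using ne bdd mid_hull_antimono
    by (intro allI impI cINF_superset_mono) fastforce+
  moreover have mK: "m n \<le> K" for n
    using m_le[OF ne] hull[OF ne] order_trans unfolding q_def by blast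
  ultimately obtain l where l: "m \<longlonglongrightarrow> l" "\<And>n. m n \<le> l"
    using incseq_convergent[of m K] by blast
  \<comment> \<open>The hulls shrink, so the infima \<open>m n\<close> increase to \<open>l\<close>.
    Far enough out, \<open>m n\<close> is close to \<open>l\<close> from below, and a near minimiser
    at that level exceeds \<open>l\<close> by little, both up to \<open>4^-i\<close>.\<close>
  have "\<exists>n g. i \<le> n \<and> g \<in> mid_hull f n \<and> l - (1/4) ^ i \<le> m n \<and> q g \<le> l + (1/4) ^ i" for i :: nat
  proof -
    have e: "0 < (1/4::real) ^ i" by simp
    obtain N where N: "\<And>n. n \<ge> N \<Longrightarrow> norm (m n - l) < (1/4) ^ i"
      using LIMSEQ_D[OF l(1) e] by auto
    define n where "n = max i N"
    have "m n < l + (1/4) ^ i" using l(2)[of n] e by linarith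
    then obtain g where "g \<in> mid_hull f n" "q g < l + (1/4) ^ i"
      unfolding m_def using cINF_less_iff[OF _ bdd, of n] ne by blast
    moreover have "l - (1/4) ^ i \<le> m n" using N[of n] by (simp add: n_def abs_less_iff)
    ultimately show ?thesis by (intro exI[of _ n] exI[of _ g]) (auto simp: n_def)
  qed
  then obtain n u where nu: "\<And>i. i \<le> n i" "\<And>i. u i \<in> mid_hull f (n i)"
    "\<And>i. l - (1/4) ^ i \<le> m (n i)" "\<And>i. q (u i) \<le> l + (1/4) ^ i"
    by metis
  have mu [measurable]: "u i \<in> borel_measurable M" and squ: "integrable M (\<lambda>x. (norm (u i x))\<^sup>2)" for i
    using hull[OF nu(2)] by auto
  have fast: "(\<integral>x. (norm (u (Suc i) x - u i x))\<^sup>2 \<partial>M) \<le> 8 * (1/4) ^ i" for i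
  proof -
    \<comment> \<open>At the smaller index both averages lie in the same hull, hence so does their
      midpoint, whose energy is therefore at least \<open>l - 4^-i\<close>. The parallelogram law
      then collects 2 + 2 + 4 = 8 errors of size \<open>4^-i\<close>.\<close>
    define p where "p = min (n i) (n (Suc i))"
    have p: "l - (1/4) ^ i \<le> m p"
      using nu(3)[of i] order_trans[OF _ nu(3)[of "Suc i"], of "l - (1/4) ^ i"]
      by (auto simp: p_def min_def)
    have "u i \<in> mid_hull f p" "u (Suc i) \<in> mid_hull f p"
      using nu(2) mid_hull_antimono unfolding p_def by (metis min.cobounded1, metis min.cobounded2)
    from m_le[OF mid_hull.mid[OF this(2,1)]]
    have "m p \<le> q (\<lambda>x. (1/2) *\<^sub>R (u (Suc i) x + u i x))" .
    moreover have "(\<integral>x. (norm (u (Suc i) x - u i x))\<^sup>2 \<partial>M) =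
        2 * q (u (Suc i)) + 2 * q (u i) - 4 * q (\<lambda>x. (1/2) *\<^sub>R (u (Suc i) x + u i x))"
      unfolding q_def by (rule square_integrable_midpoint(3)[OF mu mu squ squ])
    moreover have "q (u (Suc i)) \<le> l + (1/4) ^ i" "q (u i) \<le> l + (1/4) ^ i"
      using nu(4)[of i] order_trans[OF nu(4)[of "Suc i"], of "l + (1/4) ^ i"] by auto
    ultimately show ?thesis using p by linarith
  qed
  obtain g where "integrable M g" "AE x in M. (\<lambda>i. u i x) \<longlonglongrightarrow> g x"
    "(\<lambda>i. \<integral>x. norm (u i x - g x) \<partial>M) \<longlonglongrightarrow> 0"
  proof (rule L1_AE_limit_of_fast_L2_Cauchy[of u, OF _ _ fast])
    show "integrable M (u i)" for i
      by (rule integrable_of_square_integrable[OF mu squ])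
    show "integrable M (\<lambda>x. (norm (u (Suc i) x - u i x))\<^sup>2)" for i
      by (rule square_integrable_midpoint(2)[OF mu mu squ squ])
  qed
  moreover have "u i \<in> mid_hull f i" for i
    using nu(1,2) mid_hull_antimono by blast
  ultimately show thesis using that by blast
qed

subsection \<open>The action density and the logarithmic mean\<close>

text \<open>For positive \<open>w\<close> this is completing the square, with optimal
  \<open>p = v / w\<close>. Negative values are cut off by \<open>ennreal\<close>, which is harmless
  because \<open>p = 0\<close> contributes 0. The gain is that each \<open>p\<close> gives an
  expression linear in \<open>(v, w)\<close>, without division.\<close>

lemma alpha_eq_SUP: "alpha v w = (SUP p::real. ennreal (2 * p * v - p\<^sup>2 * w))"
proof (cases "0 < w")
  case True
  have "2 * p * v - p\<^sup>2 * w \<le> v\<^sup>2 / w" for p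
  proof -
    have "0 \<le> (p * w - v)\<^sup>2" by simp
    then have "(2 * p * v - p\<^sup>2 * w) * w \<le> v\<^sup>2"
      by (simp add: power2_eq_square algebra_simps)
    then show ?thesis using True by (simp add: pos_le_divide_eq)
  qed
  moreover have "2 * (v / w) * v - (v / w)\<^sup>2 * w = v\<^sup>2 / w"
    using True by (simp add: power2_eq_square field_simps)
  ultimately show ?thesis
    using True unfolding alpha_def
    by (intro antisym SUP_least) (auto intro!: ennreal_leI SUP_upper2[of "v / w"])
next
  case False
  show ?thesis
  proof (cases "v = 0 \<and> w = 0")
    case True
    then show ?thesis by (simp add: alpha_def)
  next
    case nz: False
    \<comment> \<open>For \<open>w \<le> 0\<close> outside the origin the supremum is unbounded: any
      level \<open>r\<close> is attained by \<open>- p^2 * w\<close> if \<open>v = 0\<close>, and at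
      least attained by the linear term with \<open>p = r / (2 * v)\<close> otherwise.\<close>
    have le: "ennreal r \<le> (SUP p::real. ennreal (2 * p * v - p\<^sup>2 * w))" if "0 \<le> r" for r
    proof (cases "v = 0")
      case True
      with False nz have "w < 0" by auto
      then have "2 * sqrt (r / - w) * v - (sqrt (r / - w))\<^sup>2 * w = r"
        using that True by (simp add: divide_nonneg_neg)
      then show ?thesis by (intro SUP_upper2[of "sqrt (r / - w)"]) auto
    next
      case v: False
      have "r \<le> 2 * (r / (2 * v)) * v - (r / (2 * v))\<^sup>2 * w"
        using v False by (simp add: mult_nonneg_nonpos)
      then show ?thesis by (intro SUP_upper2[of "r / (2 * v)"]) (simp_all only: ennreal_leI UNIV_I)
    qed
    have "(SUP p::real. ennreal (2 * p * v - p\<^sup>2 * w)) = \<infinity>"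
    proof (cases "SUP p::real. ennreal (2 * p * v - p\<^sup>2 * w)")
      case (real s)
      with le[of "s + 1"] show ?thesis by simp
    qed simp
    moreover have "alpha v w = \<infinity>" using False nz by (auto simp: alpha_def)
    ultimately show ?thesis by (simp only:)
  qed
qed

text \<open>A supremum of functions linear in \<open>(v, w)\<close> is convex.\<close>

lemma alpha_midpoint_le:
  "alpha ((1/2) * (v1 + v2)) ((1/2) * (w1 + w2)) \<le> ennreal (1/2) * (alpha v1 w1 + alpha v2 w2)"
  unfolding alpha_eq_SUP
proof (rule SUP_least)
  fix p :: real
  let ?a = "2 * p * v1 - p\<^sup>2 * w1" and ?b = "2 * p * v2 - p\<^sup>2 * w2"
  have "ennreal (2 * p * ((1/2) * (v1 + v2)) - p\<^sup>2 * ((1/2) * (w1 + w2))) = ennreal ((1/2) * (?a + ?b))"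
    by (simp add: algebra_simps add_divide_distrib diff_divide_distrib)
  also have "\<dots> = ennreal (1/2) * ennreal (?a + ?b)"
    by (rule ennreal_mult') simp
  \<comment> \<open>Truncation at 0 leaves \<open>ennreal\<close> only subadditive, which is the
    direction needed here.\<close>
  also have "ennreal (?a + ?b) \<le> ennreal ?a + ennreal ?b"
    by (auto simp: ennreal_plus_if max_def not_le ennreal_neg intro!: ennreal_leI)
  also have "\<dots> \<le> (SUP p. ennreal (2 * p * v1 - p\<^sup>2 * w1)) + (SUP p. ennreal (2 * p * v2 - p\<^sup>2 * w2))"
    by (intro add_mono SUP_upper) auto
  finally show "ennreal (2 * p * ((1/2) * (v1 + v2)) - p\<^sup>2 * ((1/2) * (w1 + w2))) \<le>
    ennreal (1/2) * ((SUP p. ennreal (2 * p * v1 - p\<^sup>2 * w1)) + (SUP p. ennreal (2 * p * v2 - p\<^sup>2 * w2)))"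
    by (simp add: mult_left_mono)
qed

lemma alpha_lsc:
  assumes "v \<longlonglongrightarrow> a" "w \<longlonglongrightarrow> b"
  shows "alpha a b \<le> liminf (\<lambda>i. alpha (v i) (w i))"
  unfolding alpha_eq_SUP[of a]
proof (rule SUP_least)
  fix p :: real
  have "(\<lambda>i. ennreal (2 * p * v i - p\<^sup>2 * w i)) \<longlonglongrightarrow> ennreal (2 * p * a - p\<^sup>2 * b)"
    by (intro tendsto_intros assms)
  then have "ennreal (2 * p * a - p\<^sup>2 * b) = liminf (\<lambda>i. ennreal (2 * p * v i - p\<^sup>2 * w i))"
    by (simp add: lim_imp_Liminf)
  also have "\<dots> \<le> liminf (\<lambda>i. alpha (v i) (w i))"
    unfolding alpha_eq_SUP by (intro Liminf_mono always_eventually allI SUP_upper) auto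
  finally show "ennreal (2 * p * a - p\<^sup>2 * b) \<le> liminf (\<lambda>i. alpha (v i) (w i))" .
qed

lemma borel_measurable_alpha [measurable (raw)]:
  assumes [measurable]: "f \<in> borel_measurable M" "g \<in> borel_measurable M"
  shows "(\<lambda>x. alpha (f x) (g x)) \<in> borel_measurable M"
  unfolding alpha_def by measurable

lemma square_le_alpha:
  assumes "0 \<le> w" "w \<le> W" "0 < W"
  shows "ennreal (v\<^sup>2) \<le> ennreal W * alpha v w"
proof (cases "w = 0")
  case True
  then show ?thesis using assms by (simp add: alpha_def ennreal_mult_top)
next
  case False
  with assms have "v\<^sup>2 \<le> W * (v\<^sup>2 / w)"
    by (simp add: pos_le_divide_eq mult.commute[of _ w] mult_right_mono)
  with False assms show ?thesis
    by (simp add: alpha_def ennreal_leI flip: ennreal_mult)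
qed

section \<open>The logarithmic mean and the weights on the simplex\<close>

lemma LogMean_integrable:
  fixes s t :: real
  assumes "0 \<le> s" "0 \<le> t"
  shows "(\<lambda>a. s powr a * t powr (1 - a)) integrable_on {0<..<1}"
proof (cases "s = 0 \<or> t = 0")
  case True
  \<comment> \<open>\<open>0 powr a\<close> is 0 for every \<open>a\<close>, also for
    \<open>a = 0\<close>, so the integrand vanishes identically.\<close>
  then have "(\<lambda>a. s powr a * t powr (1 - a)) = (\<lambda>a. 0)" by auto
  then show ?thesis by (simp only: integrable_0)
next
  case False
  then have "(\<lambda>a. s powr a * t powr (1 - a)) integrable_on {0..1}"
    using assms by (intro integrable_continuous_real continuous_intros) auto
  then show ?thesis by (simp add: integrable_on_open_interval_real)
qed

text \<open>On the closed interval the integrand fails to depend continuously on \<open>(s, t)\<close>: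
  \<open>s powr 0\<close> jumps from 1 to 0 at \<open>s = 0\<close>.\<close>
lemma LogMean_open_interval:
  "LogMean s t = integral {0<..<1} (\<lambda>a. s powr a * t powr (1 - a))"
  by (simp add: LogMean_def integral_open_interval_real)

lemma LogMean_nonneg: "0 \<le> s \<Longrightarrow> 0 \<le> t \<Longrightarrow> 0 \<le> LogMean s t"
  unfolding LogMean_open_interval using LogMean_integrable by (intro integral_nonneg) auto

lemma LogMean_tendsto:
  assumes s: "S \<longlonglongrightarrow> s" "\<And>k::nat. 0 \<le> S k" and t: "R \<longlonglongrightarrow> t" "\<And>k. 0 \<le> R k"
  shows "(\<lambda>k. LogMean (S k) (R k)) \<longlonglongrightarrow> LogMean s t"
proof -
  obtain B1 where B1: "\<And>k. norm (S k) \<le> B1"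
    using convergent_imp_bounded[OF s(1)] by (auto simp: bounded_iff)
  obtain B2 where B2: "\<And>k. norm (R k) \<le> B2"
    using convergent_imp_bounded[OF t(1)] by (auto simp: bounded_iff)
  \<comment> \<open>With \<open>B \<ge> 1\<close> each factor is at most \<open>B\<close>, whatever
    its exponent between 0 and 1, which yields a constant majorant.\<close>
  define B where "B = max 1 (max B1 B2)"
  have B: "1 \<le> B" "S k \<le> B" "R k \<le> B" for k
    using B1[of k] B2[of k] by (auto simp: B_def)
  have le: "r powr a \<le> B" if "0 \<le> r" "r \<le> B" "0 < a" "a < 1" for r a
  proof -
    have "r powr a \<le> B powr a" using that by (intro powr_mono2) auto
    also have "\<dots> \<le> B powr 1" using that B(1) by (intro powr_mono) auto
    finally show ?thesis using B(1) by simp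
  qed
  show ?thesis
    unfolding LogMean_open_interval
  proof (rule dominated_convergence(2))
    show "(\<lambda>a. B * B) integrable_on {0<..<1::real}"
      by (simp add: integrable_on_open_interval_real integrable_const_ivl)
    show "norm (S k powr a * R k powr (1 - a)) \<le> B * B" if "a \<in> {0<..<1}" for k a
      using that s(2) t(2) B le by (auto simp: norm_mult intro!: mult_mono)
    show "(\<lambda>k. S k powr a * R k powr (1 - a)) \<longlonglongrightarrow> s powr a * t powr (1 - a)" if "a \<in> {0<..<1}" for a
      using that s t by (intro tendsto_mult tendsto_powr') auto
  qed (use s t LogMean_integrable in auto)
qed

lemma norm_Prob_le: "\<mu> \<in> Prob \<Longrightarrow> norm \<mu> \<le> 1"
  using norm_le_l1_cart[of \<mu>] by (simp add: Prob_def)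

lemma compact_Prob: "compact (Prob :: (real^'x::finite) set)"
proof (rule compact_eq_bounded_closed[THEN iffD2], rule conjI)
  show "bounded (Prob :: (real^'x) set)"
    unfolding bounded_iff using norm_Prob_le by blast
  have "Prob = (\<Inter>x. {\<mu>::real^'x. 0 \<le> \<mu> $ x}) \<inter> {\<mu>. (\<Sum>x\<in>UNIV. \<mu> $ x) = 1}"
    by (auto simp: Prob_def)
  also have "closed \<dots>"
    by (intro closed_Int closed_INT ballI closed_Collect_le closed_Collect_eq continuous_intros)
  finally show "closed (Prob :: (real^'x) set)" .
qed

lemma wgt_nonneg:
  assumes "standing Q" "\<mu> \<in> Prob" "x \<noteq> y"
  shows "0 \<le> wgt Q \<mu> x y"
  unfolding wgt_def using assms
  by (intro LogMean_nonneg mult_nonneg_nonneg) (auto simp: standing_def rate_matrix_def Prob_def)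

lemma continuous_on_wgt:
  fixes Q :: "real^'x::finite \<Rightarrow> real^'x^'x"
  assumes Q: "standing Q" and "x \<noteq> y"
  shows "continuous_on Prob (\<lambda>\<mu>. wgt Q \<mu> x y)"
  unfolding continuous_on_sequentially o_def
proof (intro allI ballI impI, elim conjE)
  fix X :: "nat \<Rightarrow> real^'x" and \<mu> assume X: "\<forall>n. X n \<in> Prob" "\<mu> \<in> Prob" "X \<longlonglongrightarrow> \<mu>"
  have "continuous_on Prob (\<lambda>\<mu>. Q \<mu> $ a $ b)" for a b
    using Q lipschitz_on_continuous_on unfolding standing_def by blast
  then have Qlim: "(\<lambda>n. Q (X n) $ a $ b) \<longlonglongrightarrow> Q \<mu> $ a $ b" for a b
    using X continuous_on_sequentially[of Prob "\<lambda>\<mu>. Q \<mu> $ a $ b"] by (auto simp: o_def)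
  show "(\<lambda>n. wgt Q (X n) x y) \<longlonglongrightarrow> wgt Q \<mu> x y"
    unfolding wgt_def
  proof (rule LogMean_tendsto)
    show "0 \<le> X n $ x * Q (X n) $ x $ y" "0 \<le> X n $ y * Q (X n) $ y $ x" for n
      using Q X \<open>x \<noteq> y\<close> by (auto simp: standing_def rate_matrix_def Prob_def intro!: mult_nonneg_nonneg)
  qed (intro tendsto_mult tendsto_vec_nth Qlim X)+
qed

subsection \<open>Modulus of continuity from a weak derivative\<close>

text \<open>A \<open>C\<^sup>1\<close> step from 0 to 1 on \<open>[0, 1]\<close>; its derivative is the hat function of
  height 2 centred at \<open>1/2\<close>.\<close>
definition ramp :: "real \<Rightarrow> real" where
  "ramp u = 2 * ((max 0 u)\<^sup>2 - 2 * (max 0 (u - 1/2))\<^sup>2 + (max 0 (u - 1))\<^sup>2)"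

definition ramp_deriv :: "real \<Rightarrow> real" where
  "ramp_deriv u = 4 * (max 0 u - 2 * max 0 (u - 1/2) + max 0 (u - 1))"

text \<open>\<open>ramp\<close> is a quadratic spline: truncated squares with knots 0, 1/2, 1 and
  the weights 1, -2, 1 of a second difference. Its differentiability thus reduces to that of the
  squared positive part, where only the knot is delicate.\<close>

lemma DERIV_max_0_square: "((\<lambda>u. (max 0 u)\<^sup>2) has_real_derivative 2 * max 0 u) (at u)"
proof (cases "u = 0")
  case True
  have "((\<lambda>h::real. (max 0 h)\<^sup>2 / h) \<longlongrightarrow> 0) (at 0)"
  proof (rule Lim_null_comparison)
    show "\<forall>\<^sub>F h::real in at 0. norm ((max 0 h)\<^sup>2 / h) \<le> \<bar>h\<bar>"
      by (auto simp: max_def power2_eq_square)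
    show "((\<lambda>h::real. \<bar>h\<bar>) \<longlongrightarrow> 0) (at 0)"
      using tendsto_rabs[OF tendsto_ident_at, of "0::real" UNIV] by simp
  qed
  then show ?thesis using True by (simp add: DERIV_def)
next
  case False
  then consider "u < 0" | "0 < u" by linarith
  then show ?thesis
  proof cases
    case 1
    have "((\<lambda>_. 0) has_real_derivative 0) (at u)" by simp
    then have "((\<lambda>u. (max 0 u)\<^sup>2) has_real_derivative 0) (at u)"
      by (rule has_field_derivative_transform_within_open[where S="{..<0}"]) (use 1 in auto)
    then show ?thesis using 1 by simp
  next
    case 2
    have "((\<lambda>u. u\<^sup>2) has_real_derivative 2 * u) (at u)"
      by (auto intro!: derivative_eq_intros)
    then have "((\<lambda>u. (max 0 u)\<^sup>2) has_real_derivative 2 * u) (at u)"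
      by (rule has_field_derivative_transform_within_open[where S="{0<..}"]) (use 2 in auto)
    then show ?thesis using 2 by simp
  qed
qed

lemma DERIV_ramp: "(ramp has_real_derivative ramp_deriv u) (at u)"
proof -
  have "((\<lambda>u. (max 0 (u - a))\<^sup>2) has_real_derivative 2 * max 0 (u - a)) (at u)" for a
    by (rule DERIV_cong[OF DERIV_chain2[OF DERIV_max_0_square]]) (auto intro!: derivative_eq_intros)
  from this[of "1/2"] this[of 1] show ?thesis
    unfolding ramp_def[abs_def] ramp_deriv_def
    by (intro DERIV_cong[OF DERIV_cmult[OF DERIV_add[OF DERIV_diff[OF DERIV_max_0_square DERIV_cmult]]]])
      (assumption | simp)+
qed

lemma continuous_on_ramp_deriv: "continuous_on S ramp_deriv"
  unfolding ramp_deriv_def by (intro continuous_intros)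

lemma ramp_eq_0: "u \<le> 0 \<Longrightarrow> ramp u = 0"
  by (simp add: ramp_def)

lemma ramp_eq_1: "1 \<le> u \<Longrightarrow> ramp u = 1"
  by (simp add: ramp_def max_def power2_eq_square algebra_simps)

lemma ramp_deriv_nonneg: "0 \<le> ramp_deriv u"
  by (simp add: ramp_deriv_def max_def)

lemma ramp_deriv_eq_0: "u \<notin> {0..1} \<Longrightarrow> ramp_deriv u = 0"
  by (auto simp: ramp_deriv_def max_def)

lemma ramp_mono: "u \<le> u' \<Longrightarrow> ramp u \<le> ramp u'"
  using DERIV_nonneg_imp_nondecreasing[of u u' ramp] DERIV_ramp ramp_deriv_nonneg by blast

lemma ramp_bounds: "0 \<le> ramp u" "ramp u \<le> 1"
  using ramp_mono[of 0 u] ramp_mono[of u 1] ramp_mono[of u 0] ramp_mono[of 1 u] ramp_eq_0 ramp_eq_1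
  by (smt (verit))+

lemma DERIV_scaled_ramp:
  "((\<lambda>r. ramp (a * (r - s))) has_real_derivative a * ramp_deriv (a * (r - s))) (at r)"
  by (rule DERIV_cong[OF DERIV_chain2[OF DERIV_ramp]]) (auto intro!: derivative_eq_intros)

text \<open>As a measure space of its own, rather than a subset to integrate over, the time interval
  is open to the results on finite measures.\<close>

abbreviation leb_Icc :: "real \<Rightarrow> real measure" where
  "leb_Icc T \<equiv> restrict_space lborel {0..T}"

lemma integrable_leb_Icc_iff:
  fixes f :: "real \<Rightarrow> 'a::{banach, second_countable_topology}"
  shows "integrable (leb_Icc T) f \<longleftrightarrow> set_integrable lborel {0..T} f"
  by (simp add: set_integrable_def integrable_restrict_space)

lemma integral_leb_Icc:
  fixes f :: "real \<Rightarrow> 'a::{banach, second_countable_topology}"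
  shows "integral\<^sup>L (leb_Icc T) f = (LINT t:{0..T}|lborel. f t)"
  by (simp add: set_lebesgue_integral_def integral_restrict_space)

lemma finite_measure_leb_Icc: "finite_measure (leb_Icc T)"
  by (intro finite_measureI) (auto simp: emeasure_restrict_space space_restrict_space emeasure_lborel_Icc_eq)

lemma integrable_leb_Icc_continuous:
  fixes f :: "real \<Rightarrow> 'a::{banach, second_countable_topology}"
  shows "continuous_on {0..T} f \<Longrightarrow> integrable (leb_Icc T) f"
  unfolding integrable_leb_Icc_iff by (rule borel_integrable_atLeastAtMost')

text \<open>The scaled hat lives on \<open>[s, s + 1/a]\<close>. The hypotheses place this interval
  inside \<open>[0, T]\<close>, so no mass is lost.\<close>

lemma integral_scaled_ramp_deriv:
  assumes "0 < s" "0 < a" "1 \<le> a * (T - s)"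
  shows "(\<integral>r. a * ramp_deriv (a * (r - s)) \<partial>leb_Icc T) = 1"
proof -
  have "s < T" using assms by (smt (verit) mult_nonneg_nonpos)
  have "(\<integral>r. a * ramp_deriv (a * (r - s)) \<partial>leb_Icc T) = ramp (a * (T - s)) - ramp (a * (0 - s))"
    unfolding integral_leb_Icc set_lebesgue_integral_def
  proof (rule integral_FTC_atLeastAtMost)
    show "continuous_on {0..T} (\<lambda>r. a * ramp_deriv (a * (r - s)))"
      by (intro continuous_intros continuous_on_compose2[OF continuous_on_ramp_deriv[of UNIV]]) auto
    show "((\<lambda>r. ramp (a * (r - s))) has_vector_derivative a * ramp_deriv (a * (r - s))) (at r within {0..T})" for r
      using DERIV_scaled_ramp[of a s r]
      by (simp add: has_real_derivative_iff_has_vector_derivative has_vector_derivative_at_within)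
  qed (use assms \<open>s < T\<close> in auto)
  also have "\<dots> = 1"
    using assms by (simp add: ramp_eq_0 ramp_eq_1 mult_nonneg_nonpos)
  finally show ?thesis .
qed

text \<open>The kernels have mass one for large \<open>n\<close> and live on
  \<open>[s, s + 1/n]\<close>, so they average \<open>c\<close> over a shrinking interval to the
  right of \<open>s\<close>.\<close>

lemma ramp_deriv_approximate_identity:
  fixes c :: "real \<Rightarrow> real"
  assumes c: "continuous_on {0..T} c" and s: "0 < s" "s < T"
  shows "(\<lambda>n. \<integral>r. real n * ramp_deriv (real n * (r - s)) * c r \<partial>leb_Icc T) \<longlonglongrightarrow> c s"
proof (rule LIMSEQ_I)
  fix e :: real assume "0 < e"
  obtain \<delta> where \<delta>: "0 < \<delta>" "\<And>r. r \<in> {0..T} \<Longrightarrow> dist r s < \<delta> \<Longrightarrow> dist (c r) (c s) < e / 2"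
    using c s \<open>0 < e\<close> unfolding continuous_on_iff by (metis atLeastAtMost_iff half_gt_zero less_imp_le)
  \<comment> \<open>The first bound puts the support of the kernel within \<open>\<delta>\<close> of
    \<open>s\<close>, the second keeps it inside \<open>[0, T]\<close>.\<close>
  obtain N where N: "1 / \<delta> < real N" "1 / (T - s) < real N" "0 < N"
  proof -
    obtain N where "max (1 / \<delta>) (1 / (T - s)) < real N" using reals_Archimedean2 by blast
    moreover have "0 < 1 / \<delta>" using \<delta> by simp
    ultimately have "1 / \<delta> < real N" "1 / (T - s) < real N" "0 < real N" by linarith+
    then show thesis using that by simp
  qed
  have "norm ((\<integral>r. real n * ramp_deriv (real n * (r - s)) * c r \<partial>leb_Icc T) - c s) < e" if "N \<le> n" for n
  proof -
    let ?\<psi> = "\<lambda>r. real n * ramp_deriv (real n * (r - s))"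
    have n: "1 / \<delta> < real n" "1 / (T - s) < real n" "0 < real n" using N that by linarith+
    have cont: "continuous_on {0..T} ?\<psi>"
      by (intro continuous_intros continuous_on_compose2[OF continuous_on_ramp_deriv[of UNIV]]) auto
    have one: "(\<integral>r. ?\<psi> r \<partial>leb_Icc T) = 1"
      using n s by (intro integral_scaled_ramp_deriv) (auto simp: field_simps)
    have int: "integrable (leb_Icc T) ?\<psi>" "integrable (leb_Icc T) (\<lambda>r. ?\<psi> r * c r)"
      "integrable (leb_Icc T) (\<lambda>r. ?\<psi> r * (c r - c s))"
      by (intro integrable_leb_Icc_continuous continuous_intros cont c)+
    have "(\<integral>r. ?\<psi> r * c r \<partial>leb_Icc T) - c s =
        (\<integral>r. ?\<psi> r * c r \<partial>leb_Icc T) - (\<integral>r. ?\<psi> r * c s \<partial>leb_Icc T)"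
      using one by simp
    also have "\<dots> = (\<integral>r. ?\<psi> r * c r - ?\<psi> r * c s \<partial>leb_Icc T)"
      using int by (intro Bochner_Integration.integral_diff[symmetric]) auto
    finally have "norm ((\<integral>r. ?\<psi> r * c r \<partial>leb_Icc T) - c s) = norm (\<integral>r. ?\<psi> r * (c r - c s) \<partial>leb_Icc T)"
      by (simp only: right_diff_distrib)
    also have "\<dots> \<le> (\<integral>r. norm (?\<psi> r * (c r - c s)) \<partial>leb_Icc T)"
      by (rule integral_norm_bound)
    also have "\<dots> \<le> (\<integral>r. ?\<psi> r * (e / 2) \<partial>leb_Icc T)"
    proof (rule integral_mono)
      fix r assume "r \<in> space (leb_Icc T)"
      then have r: "r \<in> {0..T}" by (simp add: space_restrict_space)
      show "norm (?\<psi> r * (c r - c s)) \<le> ?\<psi> r * (e / 2)"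
      proof (cases "real n * (r - s) \<in> {0..1}")
        case True
        then have "0 \<le> r - s" "r - s \<le> 1 / real n" using n by (auto simp: zero_le_mult_iff field_simps)
        moreover have "1 / real n < \<delta>" using n \<delta> by (simp add: field_simps)
        ultimately have "\<bar>c r - c s\<bar> \<le> e / 2" using \<delta>(2)[OF r] by (simp add: dist_real_def)
        then show ?thesis
          using n ramp_deriv_nonneg[of "real n * (r - s)"] by (simp add: abs_mult mult_left_mono)
      qed (simp add: ramp_deriv_eq_0)
    qed (use int in auto)
    also have "\<dots> = e / 2" using one by simp
    finally show ?thesis using \<open>0 < e\<close> by simp
  qed
  then show "\<exists>N. \<forall>n\<ge>N. norm ((\<integral>r. real n * ramp_deriv (real n * (r - s)) * c r \<partial>leb_Icc T) - c s) < e"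
    by blast
qed

text \<open>Tested with a smoothed indicator of \<open>[s, t]\<close>, the weak equation says that
  two averages of \<open>c\<close>, near \<open>s\<close> and near \<open>t\<close>, differ by the
  integral of \<open>\<phi> * g\<close>. Young's inequality with a free \<open>\<eta>\<close> stands
  in for Cauchy-Schwarz; optimising over \<open>\<eta>\<close> for positive \<open>K\<close> would
  give \<open>sqrt (K * (t - s))\<close>.\<close>

lemma weak_derivative_interior_modulus:
  fixes c g :: "real \<Rightarrow> real"
  assumes c: "continuous_on {0..T} c"
    and g: "integrable (leb_Icc T) g" "integrable (leb_Icc T) (\<lambda>r. (g r)\<^sup>2)"
    and K: "(\<integral>r. (g r)\<^sup>2 \<partial>leb_Icc T) \<le> K"
    and weak: "\<And>\<phi>. test_fun T \<phi> \<Longrightarrow> (\<integral>r. deriv \<phi> r * c r - \<phi> r * g r \<partial>leb_Icc T) = 0"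
    and st: "0 < s" "s < t" "t < T" and "0 < \<eta>"
  shows "\<bar>c s - c t\<bar> \<le> (\<eta> * K + (t - s) / \<eta>) / 2"
proof -
  interpret finite_measure "leb_Icc T" by (rule finite_measure_leb_Icc)
  let ?b = "\<lambda>n s r. real n * ramp_deriv (real n * (r - s))"
  \<comment> \<open>Both ramps rise to the right of their base points, so the support reaches up to
    \<open>t + 1/n\<close>; it fits below \<open>T\<close> because \<open>t < T\<close> and
    \<open>n\<close> is large.\<close>
  define \<phi> where "\<phi> n r = ramp (real n * (r - s)) - ramp (real n * (r - t))" for n r
  have der: "(\<phi> n has_real_derivative ?b n s r - ?b n t r) (at r)" for n r
    unfolding \<phi>_def[abs_def] by (intro DERIV_diff DERIV_scaled_ramp)
  have bcont: "continuous_on S (?b n s)" for S n s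
    by (intro continuous_intros continuous_on_compose2[OF continuous_on_ramp_deriv[of UNIV]]) auto
  have bound: "\<bar>(\<integral>r. ?b n s r * c r \<partial>leb_Icc T) - (\<integral>r. ?b n t r * c r \<partial>leb_Icc T)\<bar>
      \<le> (\<eta> * K + (t - s + 1 / real n) / \<eta>) / 2" if n: "1 / (T - t) < real n" for n
  proof -
    have "0 < 1 / (T - t)" using st by simp
    with n have n0: "0 < real n" by linarith
    have tT: "t + 1 / real n < T" using n n0 st by (simp add: field_simps)
    have supp: "\<phi> n r = 0" if "r \<notin> {s..t + 1 / real n}" for r
    proof (cases "r < s")
      case True
      then show ?thesis using st n0 by (simp add: \<phi>_def ramp_eq_0 mult_nonneg_nonpos)
    next
      case False
      with that have r: "t + 1 / real n < r" by simp
      then have "1 \<le> real n * (r - t)" using n0 by (simp add: field_simps)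
      moreover have "real n * (r - t) \<le> real n * (r - s)" using n0 st by simp
      ultimately show ?thesis by (simp add: \<phi>_def ramp_eq_1)
    qed
    have test: "test_fun T (\<phi> n)"
      unfolding test_fun_def C1_differentiable_on_def
    proof (intro conjI exI ballI)
      show "(\<phi> n has_vector_derivative ?b n s r - ?b n t r) (at r)" for r
        using der by (simp add: has_real_derivative_iff_has_vector_derivative)
      show "continuous_on UNIV (\<lambda>r. ?b n s r - ?b n t r)"
        by (intro continuous_on_diff bcont)
      show "0 < s" "t + 1 / real n < T" by fact+
    qed (use supp in blast)
    have deriv: "deriv (\<phi> n) r = ?b n s r - ?b n t r" for r
      using der by (rule DERIV_imp_deriv)
    have \<phi>cont: "continuous_on S (\<phi> n)" for S
      using der DERIV_isCont by (intro continuous_at_imp_continuous_on ballI) blast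
    have \<phi>01: "0 \<le> \<phi> n r" "\<phi> n r \<le> 1" for r
    proof -
      have "real n * (r - t) \<le> real n * (r - s)" using n0 st by simp
      then show "0 \<le> \<phi> n r" using ramp_mono by (simp add: \<phi>_def)
      show "\<phi> n r \<le> 1"
        using ramp_bounds[of "real n * (r - s)"] ramp_bounds[of "real n * (r - t)"] by (simp add: \<phi>_def)
    qed
    have \<phi>meas [measurable]: "\<phi> n \<in> borel_measurable (leb_Icc T)"
      using integrable_leb_Icc_continuous[OF \<phi>cont] by blast
    have gmeas [measurable]: "g \<in> borel_measurable (leb_Icc T)" using g by auto
    have \<phi>g: "integrable (leb_Icc T) (\<lambda>r. \<phi> n r * g r)"
      by (rule Bochner_Integration.integrable_bound[OF g(1)])
         (use \<phi>01 in \<open>auto simp: abs_mult intro!: mult_left_le_one_le\<close>)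
    have \<phi>int: "integrable (leb_Icc T) (\<phi> n)" by (rule integrable_leb_Icc_continuous[OF \<phi>cont])
    have int: "integrable (leb_Icc T) (\<lambda>r. ?b n s r * c r)" for s
      by (intro integrable_leb_Icc_continuous continuous_on_mult bcont c)
    have "0 = (\<integral>r. deriv (\<phi> n) r * c r - \<phi> n r * g r \<partial>leb_Icc T)"
      using weak[OF test] by simp
    also have "\<dots> = (\<integral>r. (?b n s r * c r - ?b n t r * c r) - \<phi> n r * g r \<partial>leb_Icc T)"
      by (simp only: deriv left_diff_distrib)
    also have "\<dots> = (\<integral>r. ?b n s r * c r \<partial>leb_Icc T) - (\<integral>r. ?b n t r * c r \<partial>leb_Icc T)
        - (\<integral>r. \<phi> n r * g r \<partial>leb_Icc T)"
      using int \<phi>g by (subst Bochner_Integration.integral_diff; (subst Bochner_Integration.integral_diff)?; simp)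
    finally have "\<bar>(\<integral>r. ?b n s r * c r \<partial>leb_Icc T) - (\<integral>r. ?b n t r * c r \<partial>leb_Icc T)\<bar>
        = \<bar>\<integral>r. \<phi> n r * g r \<partial>leb_Icc T\<bar>" by simp
    also have "\<dots> \<le> (\<integral>r. \<bar>\<phi> n r * g r\<bar> \<partial>leb_Icc T)" by (rule integral_abs_bound)
    also have "\<dots> \<le> (\<integral>r. (\<eta> / 2) * (g r)\<^sup>2 + (1 / (2 * \<eta>)) * \<phi> n r \<partial>leb_Icc T)"
    proof (rule integral_mono)
      fix r
      \<comment> \<open>Dividing by \<open>2 * \<eta>\<close> gives Young's inequality. The factor
        \<open>\<phi>\<close> is dropped only from the quadratic term; on the constant it is kept,
        since its integral produces the length \<open>t - s + 1/n\<close>.\<close>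
      have "0 \<le> (\<eta> * \<bar>g r\<bar> - 1)\<^sup>2" by simp
      then have "2 * \<eta> * \<bar>g r\<bar> \<le> \<eta> * \<eta> * (g r)\<^sup>2 + 1"
        by (simp add: power2_eq_square algebra_simps)
      then have "\<bar>g r\<bar> \<le> (\<eta> / 2) * (g r)\<^sup>2 + 1 / (2 * \<eta>)"
        using \<open>0 < \<eta>\<close> by (simp add: field_simps)
      then have "\<phi> n r * \<bar>g r\<bar> \<le> \<phi> n r * ((\<eta> / 2) * (g r)\<^sup>2) + \<phi> n r * (1 / (2 * \<eta>))"
        using \<phi>01(1)[of r] by (metis mult_left_mono distrib_left)
      also have "\<phi> n r * ((\<eta> / 2) * (g r)\<^sup>2) \<le> (\<eta> / 2) * (g r)\<^sup>2"
        using \<phi>01[of r] \<open>0 < \<eta>\<close> by (intro mult_left_le_one_le) auto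
      finally show "\<bar>\<phi> n r * g r\<bar> \<le> (\<eta> / 2) * (g r)\<^sup>2 + (1 / (2 * \<eta>)) * \<phi> n r"
        using \<phi>01(1)[of r] by (simp add: abs_mult mult.commute)
    qed (use \<phi>g \<phi>int g in auto)
    also have "\<dots> = (\<eta> / 2) * (\<integral>r. (g r)\<^sup>2 \<partial>leb_Icc T) + (1 / (2 * \<eta>)) * (\<integral>r. \<phi> n r \<partial>leb_Icc T)"
      using \<phi>int g by (subst Bochner_Integration.integral_add) auto
    also have "\<dots> \<le> (\<eta> / 2) * K + (1 / (2 * \<eta>)) * (t - s + 1 / real n)"
    proof (intro add_mono mult_left_mono K)
      have "(\<integral>r. \<phi> n r \<partial>leb_Icc T) \<le> (\<integral>r. indicator {s..t + 1 / real n} r \<partial>leb_Icc T)"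
      proof (rule integral_mono[OF \<phi>int])
        show "integrable (leb_Icc T) (indicator {s..t + 1 / real n} :: real \<Rightarrow> real)"
          by (rule integrable_const_bound[of _ 1]) (auto intro: measurable_restrict_space1)
        show "\<phi> n r \<le> indicator {s..t + 1 / real n} r" for r
          using \<phi>01[of r] supp[of r] by (auto simp: indicator_def)
      qed
      also have "\<dots> = (\<integral>r. indicator {s..t + 1 / real n} r \<partial>lborel)"
        unfolding integral_leb_Icc set_lebesgue_integral_def
        using st tT by (intro Bochner_Integration.integral_cong) (auto simp: indicator_def)
      also have "\<dots> = t - s + 1 / real n"
      proof -
        have "0 < 1 / real n" using n0 by simp
        then have "s \<le> t + 1 / real n" using st by linarith
        then show ?thesis by simp
      qed
      finally show "(\<integral>r. \<phi> n r \<partial>leb_Icc T) \<le> t - s + 1 / real n" .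
    qed (use \<open>0 < \<eta>\<close> in auto)
    finally show ?thesis using \<open>0 < \<eta>\<close> by (simp add: field_simps)
  qed
  have lim1: "(\<lambda>n. \<bar>(\<integral>r. ?b n s r * c r \<partial>leb_Icc T) - (\<integral>r. ?b n t r * c r \<partial>leb_Icc T)\<bar>) \<longlonglongrightarrow> \<bar>c s - c t\<bar>"
    using st by (intro tendsto_rabs tendsto_diff ramp_deriv_approximate_identity c) auto
  have lim2: "(\<lambda>n. (\<eta> * K + (t - s + 1 / real n) / \<eta>) / 2) \<longlonglongrightarrow> (\<eta> * K + (t - s + 0) / \<eta>) / 2"
    using \<open>0 < \<eta>\<close> by (intro tendsto_intros lim_1_over_n) auto
  have "\<forall>\<^sub>F n in sequentially. 1 / (T - t) < real n"
    using filterlim_at_top_dense[THEN iffD1, OF filterlim_real_sequentially] by blast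
  from tendsto_le[OF sequentially_bot lim2 lim1 eventually_mono[OF this bound]]
  show ?thesis by simp
qed
text \<open>Test functions vanish near 0 and \<open>T\<close>, so the endpoints are reached only
  through the continuity of \<open>c\<close>, as limits of interior points.\<close>

lemma weak_derivative_modulus:
  fixes c g :: "real \<Rightarrow> real"
  assumes c: "continuous_on {0..T} c" and "0 < T"
    and g: "integrable (leb_Icc T) g" "integrable (leb_Icc T) (\<lambda>r. (g r)\<^sup>2)"
    and K: "(\<integral>r. (g r)\<^sup>2 \<partial>leb_Icc T) \<le> K"
    and weak: "\<And>\<phi>. test_fun T \<phi> \<Longrightarrow> (\<integral>r. deriv \<phi> r * c r - \<phi> r * g r \<partial>leb_Icc T) = 0"
    and st: "s \<in> {0..T}" "t \<in> {0..T}" and "0 < \<eta>"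
  shows "\<bar>c s - c t\<bar> \<le> (\<eta> * K + \<bar>s - t\<bar> / \<eta>) / 2"
proof -
  have "0 \<le> K" by (rule order_trans[OF _ K]) simp
  define S where "S = {0<..<T} \<times> {0<..<T}"
  have cl: "closure S = {0..T} \<times> {0..T}"
    using \<open>0 < T\<close> by (simp add: S_def closure_Times)
  have "\<bar>c (fst p) - c (snd p)\<bar> \<le> (\<eta> * K + \<bar>fst p - snd p\<bar> / \<eta>) / 2" if "p \<in> S" for p
  proof -
    note mod = weak_derivative_interior_modulus[OF c g K weak _ _ _ \<open>0 < \<eta>\<close>]
    consider "fst p < snd p" | "fst p = snd p" | "snd p < fst p" by linarith
    then show ?thesis
    proof cases
      case 1
      with mod[of "fst p" "snd p"] that show ?thesis by (auto simp: S_def)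
    next
      case 2
      with \<open>0 < \<eta>\<close> \<open>0 \<le> K\<close> show ?thesis by simp
    next
      case 3
      with mod[of "snd p" "fst p"] that show ?thesis
        by (auto simp: S_def abs_minus_commute)
    qed
  qed
  \<comment> \<open>The closure principle compares a continuous function with a constant, so the
    term in \<open>|s - t|\<close> moves to the left.\<close>
  then have le: "\<bar>c (fst p) - c (snd p)\<bar> - (\<bar>fst p - snd p\<bar> / \<eta>) / 2 \<le> (\<eta> * K) / 2" if "p \<in> S" for p
    using that by (simp only: add_divide_distrib) (smt (verit))
  have "continuous_on (closure S) (\<lambda>p. \<bar>c (fst p) - c (snd p)\<bar> - \<bar>fst p - snd p\<bar> / \<eta> / 2)"
    unfolding cl using \<open>0 < \<eta>\<close>
    by (intro continuous_intros continuous_on_compose2[OF c]) auto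
  from continuous_le_on_closure[OF this _ le, of "(s, t)"] st show ?thesis
    unfolding cl by (simp add: add_divide_distrib)
qed

subsection \<open>The action as a function of flux and weight matrices\<close>

text \<open>Neither the action nor the divergence sees the diagonal of a flux, so an action bound
  cannot control it. Erasing it changes neither of them and lets the bound cover the whole
  matrix.\<close>

definition offdiag :: "real^'x^'x \<Rightarrow> real^'x^'x" where
  "offdiag v = (\<chi> x y. if x = y then 0 else v $ x $ y)"

definition wgt_matrix :: "(real^'x \<Rightarrow> real^'x^'x) \<Rightarrow> real^'x \<Rightarrow> real^'x^'x" where
  "wgt_matrix Q \<mu> = offdiag (\<chi> x y. wgt Q \<mu> x y)"

text \<open>Flux and weight are separate arguments because an averaged weight matrix need not be the
  weight matrix of any curve point.\<close>

definition matrix_action :: "real^'x^'x \<Rightarrow> real^'x^'x \<Rightarrow> ennreal" where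
  "matrix_action v w = ennreal (1/2) * (\<Sum>(x, y)\<in>{(a, b). a \<noteq> b}. alpha (v $ x $ y) (w $ x $ y))"

lemma Action_eq_matrix_action: "Action Q \<mu> v = matrix_action v (wgt_matrix Q \<mu>)"
  unfolding Action_def matrix_action_def wgt_matrix_def offdiag_def
  by (intro arg_cong2[where f="(*)"] sum.cong) auto

lemma matrix_action_offdiag: "matrix_action (offdiag v) w = matrix_action v w"
  unfolding matrix_action_def offdiag_def by (intro arg_cong2[where f="(*)"] sum.cong) auto

lemma linear_offdiag: "linear offdiag"
  by (rule linearI) (auto simp: offdiag_def vec_eq_iff)

lemma divg_offdiag: "divg (offdiag v) x = divg v x"
  unfolding divg_def offdiag_def by (intro arg_cong2[where f="(*)"] sum.cong) auto

lemma linear_divg: "linear (\<lambda>v. divg v x)"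
proof (rule linearI)
  show "divg (v + w) x = divg v x + divg w x" for v w
    unfolding divg_def by (simp add: sum.distrib sum_subtractf algebra_simps)
  show "divg (r *\<^sub>R v) x = r *\<^sub>R divg v x" for r v
    unfolding divg_def by (simp add: right_diff_distrib[symmetric] sum_distrib_left[symmetric])
qed

lemma matrix_action_midpoint_le:
  "matrix_action ((1/2) *\<^sub>R (v1 + v2)) ((1/2) *\<^sub>R (w1 + w2))
    \<le> ennreal (1/2) * (matrix_action v1 w1 + matrix_action v2 w2)"
proof -
  let ?I = "{(a, b). a \<noteq> b} :: ('a \<times> 'a) set"
  have "matrix_action ((1/2) *\<^sub>R (v1 + v2)) ((1/2) *\<^sub>R (w1 + w2)) \<le> ennreal (1/2) *
    (\<Sum>p\<in>?I. ennreal (1/2) * (alpha (v1 $ fst p $ snd p) (w1 $ fst p $ snd p)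
      + alpha (v2 $ fst p $ snd p) (w2 $ fst p $ snd p)))"
    unfolding matrix_action_def case_prod_unfold
    by (intro mult_left_mono sum_mono) (use alpha_midpoint_le in auto)
  also have "\<dots> = ennreal (1/2) * (matrix_action v1 w1 + matrix_action v2 w2)"
    unfolding matrix_action_def case_prod_unfold
    by (simp only: sum_distrib_left[symmetric] sum.distrib distrib_left)
  finally show ?thesis .
qed

lemma matrix_action_lsc:
  fixes v w :: "nat \<Rightarrow> real^'x::finite^'x"
  assumes "v \<longlonglongrightarrow> a" "w \<longlonglongrightarrow> b"
  shows "matrix_action a b \<le> liminf (\<lambda>i. matrix_action (v i) (w i))"
proof -
  let ?I = "{(a, b). a \<noteq> b} :: ('x \<times> 'x) set"
  let ?A = "\<lambda>i p. ennreal (1/2) * alpha (v i $ fst p $ snd p) (w i $ fst p $ snd p)"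
  \<comment> \<open>Writing the finite sum as an integral for the counting measure lets Fatou's
    lemma move the lower limit out of the sum.\<close>
  have eq: "matrix_action v w = (\<integral>\<^sup>+p. ennreal (1/2) * alpha (v $ fst p $ snd p) (w $ fst p $ snd p) \<partial>count_space ?I)"
    for v w :: "real^'x^'x"
    unfolding matrix_action_def case_prod_unfold by (simp add: nn_integral_count_space_finite sum_distrib_left)
  have "ennreal (1/2) * alpha (a $ x $ y) (b $ x $ y) \<le> liminf (\<lambda>i. ?A i (x, y))" for x y
  proof -
    have "ennreal (1/2) * alpha (a $ x $ y) (b $ x $ y)
        \<le> ennreal (1/2) * liminf (\<lambda>i. alpha (v i $ x $ y) (w i $ x $ y))"
      using assms by (intro mult_left_mono alpha_lsc tendsto_vec_nth) auto
    also have "\<dots> = liminf (\<lambda>i. ?A i (x, y))"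
      by (subst Liminf_compose_continuous_mono[where f="\<lambda>z. ennreal (1/2) * z"])
         (auto intro!: monoI mult_left_mono ennreal_continuous_on_cmult continuous_on_id simp del: ennreal_half)
    finally show ?thesis .
  qed
  then have "matrix_action a b \<le> (\<integral>\<^sup>+p. liminf (\<lambda>i. ?A i p) \<partial>count_space ?I)"
    unfolding eq by (intro nn_integral_mono) (auto simp: split_beta)
  also have "\<dots> \<le> liminf (\<lambda>i. matrix_action (v i) (w i))"
    unfolding eq by (rule nn_integral_liminf) simp
  finally show ?thesis .
qed

lemma borel_measurable_matrix_action:
  assumes "f \<in> borel_measurable M" "g \<in> borel_measurable M"
  shows "(\<lambda>t. matrix_action (f t) (g t)) \<in> borel_measurable M"
proof -
  have [measurable]: "(\<lambda>t. f t $ x $ y) \<in> borel_measurable M" "(\<lambda>t. g t $ x $ y) \<in> borel_measurable M" for x y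
    using assms by (auto intro!: borel_measurable_continuous_on[where f="\<lambda>v. v $ x $ y"] continuous_intros)
  show ?thesis unfolding matrix_action_def case_prod_unfold by measurable
qed

section \<open>Bounds on weights and fluxes\<close>

lemma wgt_bounded:
  fixes Q :: "real^'x::finite \<Rightarrow> real^'x^'x"
  assumes "standing Q"
  obtains W where "0 < W" "\<And>\<mu> x y. \<mu> \<in> Prob \<Longrightarrow> x \<noteq> y \<Longrightarrow> wgt Q \<mu> x y \<le> W"
proof -
  have "\<exists>B. \<forall>\<mu>\<in>Prob. x \<noteq> y \<longrightarrow> wgt Q \<mu> x y \<le> B" for x y
  proof (cases "x = y")
    case False
    have "compact ((\<lambda>\<mu>. wgt Q \<mu> x y) ` Prob)"
      by (rule compact_continuous_image[OF continuous_on_wgt[OF assms False] compact_Prob])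
    from compact_imp_bounded[OF this]
    obtain B where "\<forall>r\<in>(\<lambda>\<mu>. wgt Q \<mu> x y) ` Prob. norm r \<le> B"
      unfolding bounded_iff ..
    then show ?thesis by (intro exI[of _ B]) auto
  qed simp
  then obtain B where B: "\<And>\<mu> x y. \<mu> \<in> Prob \<Longrightarrow> x \<noteq> y \<Longrightarrow> wgt Q \<mu> x y \<le> B x y"
    by metis
  \<comment> \<open>The sum bounds all pairs at once; the summand 1 makes \<open>W\<close>
    positive.\<close>
  define W where "W = 1 + (\<Sum>x\<in>UNIV. \<Sum>y\<in>UNIV. \<bar>B x y\<bar>)"
  have "B x y \<le> W" for x y
  proof -
    have "\<bar>B x y\<bar> \<le> (\<Sum>y\<in>UNIV. \<bar>B x y\<bar>)" by (rule member_le_sum) auto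
    also have "\<dots> \<le> (\<Sum>x\<in>UNIV. \<Sum>y\<in>UNIV. \<bar>B x y\<bar>)"
      by (rule member_le_sum[of x UNIV "\<lambda>x. \<Sum>y\<in>UNIV. \<bar>B x y\<bar>"]) (auto intro: sum_nonneg)
    finally show ?thesis by (simp add: W_def)
  qed
  moreover have "0 < W" unfolding W_def by (intro add_pos_nonneg sum_nonneg) auto
  ultimately show thesis using that[of W] order_trans[OF B] by simp
qed

lemma continuous_on_wgt_matrix:
  assumes "standing Q"
  shows "continuous_on Prob (wgt_matrix Q)"
  unfolding wgt_matrix_def offdiag_def
proof (intro continuous_on_vec_lambda)
  show "continuous_on Prob (\<lambda>\<mu>. if x = y then 0 else (\<chi> x y. wgt Q \<mu> x y) $ x $ y)" for x y
    using continuous_on_wgt[OF assms, of x y] by (cases "x = y") auto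
qed

lemma norm_matrix_square: "(norm (v :: real^'x^'x))\<^sup>2 = (\<Sum>x\<in>UNIV. \<Sum>y\<in>UNIV. (v $ x $ y)\<^sup>2)"
  by (simp add: norm_vec_def L2_set_def sum_nonneg)

text \<open>Each squared entry is at most \<open>W\<close> times its term of the action; the factor
  2 undoes the 1/2 in front of the sum.\<close>

lemma norm_offdiag_square_le_Action:
  assumes "standing Q" "\<mu> \<in> Prob" "0 < W" and W: "\<And>x y. x \<noteq> y \<Longrightarrow> wgt Q \<mu> x y \<le> W"
  shows "ennreal ((norm (offdiag v))\<^sup>2) \<le> ennreal (2 * W) * Action Q \<mu> v"
proof -
  let ?I = "{(a, b). a \<noteq> b} :: ('a \<times> 'a) set"
  have "(norm (offdiag v))\<^sup>2 = (\<Sum>p\<in>UNIV. (offdiag v $ fst p $ snd p)\<^sup>2)"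
    unfolding norm_matrix_square by (simp add: sum.cartesian_product case_prod_unfold)
  also have "\<dots> = (\<Sum>p\<in>?I. (v $ fst p $ snd p)\<^sup>2)"
    by (intro sum.mono_neutral_cong_right) (auto simp: offdiag_def)
  finally have "ennreal ((norm (offdiag v))\<^sup>2) = (\<Sum>p\<in>?I. ennreal ((v $ fst p $ snd p)\<^sup>2))"
    by (simp add: sum_ennreal)
  also have "\<dots> \<le> (\<Sum>p\<in>?I. ennreal W * alpha (v $ fst p $ snd p) (wgt Q \<mu> (fst p) (snd p)))"
    using assms wgt_nonneg[OF assms(1,2)] by (intro sum_mono square_le_alpha) auto
  also have "\<dots> = ennreal W * (\<Sum>p\<in>?I. alpha (v $ fst p $ snd p) (wgt Q \<mu> (fst p) (snd p)))"
    by (simp add: sum_distrib_left)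
  also have "ennreal W = ennreal (2 * W) * ennreal (1/2)"
    using \<open>0 < W\<close> by (subst ennreal_mult[symmetric]) auto
  finally show ?thesis
    unfolding Action_def case_prod_unfold by (simp only: mult.assoc)
qed

lemma ActionInt_eq: "ActionInt Q T c v = (\<integral>\<^sup>+t. Action Q (c t) (v t) \<partial>leb_Icc T)"
  unfolding ActionInt_def by (simp add: nn_integral_restrict_space)

lemma measurable_leb_Icc_continuous:
  "continuous_on {0..T} f \<Longrightarrow> f \<in> borel_measurable (leb_Icc T)"
  using borel_measurable_continuous_on_restrict[of "{0..T}" f] 
  by (subst measurable_cong_sets[OF sets_restrict_space_cong[OF sets_lborel] refl])

subsection \<open>Compactness\<close>

text \<open>The constant has \<open>max 0 C\<close> because \<open>ennreal C\<close> is 0 for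
  negative \<open>C\<close>. The flux is only assumed integrable; its square integrability comes
  from the finite action.\<close>

lemma integral_square_offdiag_le:
  assumes Q: "standing Q" and CE: "CE T \<mu> \<nu> c v" and act: "ActionInt Q T c v \<le> ennreal C"
    and W: "0 < W" "\<And>\<mu> x y. \<mu> \<in> Prob \<Longrightarrow> x \<noteq> y \<Longrightarrow> wgt Q \<mu> x y \<le> W"
  shows "integrable (leb_Icc T) (\<lambda>t. (norm (offdiag (v t)))\<^sup>2)"
    and "(\<integral>t. (norm (offdiag (v t)))\<^sup>2 \<partial>leb_Icc T) \<le> 2 * W * max 0 C"
proof -
  have [measurable]: "(\<lambda>t. offdiag (v t)) \<in> borel_measurable (leb_Icc T)"
    using CE linear_continuous_on[OF linear_linear[THEN iffD2, OF linear_offdiag]]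
    by (intro borel_measurable_continuous_on[where f=offdiag])
      (auto simp: CE_def simp flip: integrable_leb_Icc_iff)
  have "(\<integral>\<^sup>+t. ennreal ((norm (offdiag (v t)))\<^sup>2) \<partial>leb_Icc T)
      \<le> (\<integral>\<^sup>+t. ennreal (2 * W) * Action Q (c t) (v t) \<partial>leb_Icc T)"
    using CE W by (intro nn_integral_mono norm_offdiag_square_le_Action Q)
      (auto simp: CE_def space_restrict_space)
  also have "\<dots> = ennreal (2 * W) * ActionInt Q T c v"
    unfolding ActionInt_eq
  proof (rule nn_integral_cmult)
    have "(\<lambda>t. wgt_matrix Q (c t)) \<in> borel_measurable (leb_Icc T)"
      using CE continuous_on_compose2[OF continuous_on_wgt_matrix[OF Q], of "{0..T}" c]
      by (intro measurable_leb_Icc_continuous) (auto simp: CE_def)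
    then show "(\<lambda>t. Action Q (c t) (v t)) \<in> borel_measurable (leb_Icc T)"
      unfolding Action_eq_matrix_action matrix_action_offdiag[of "v _", symmetric]
      by (intro borel_measurable_matrix_action) auto
  qed
  also have "\<dots> \<le> ennreal (2 * W) * ennreal (max 0 C)"
    using act by (intro mult_left_mono) (auto simp: max_def ennreal_neg)
  also have "\<dots> = ennreal (2 * W * max 0 C)"
    using W by (intro ennreal_mult[symmetric]) auto
  finally have le: "(\<integral>\<^sup>+t. ennreal ((norm (offdiag (v t)))\<^sup>2) \<partial>leb_Icc T) \<le> ennreal (2 * W * max 0 C)" .
  show int: "integrable (leb_Icc T) (\<lambda>t. (norm (offdiag (v t)))\<^sup>2)"
    by (rule integrableI_bounded) (use le in \<open>auto intro: le_less_trans\<close>)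
  show "(\<integral>t. (norm (offdiag (v t)))\<^sup>2 \<partial>leb_Icc T) \<le> 2 * W * max 0 C"
    using le W by (subst (asm) nn_integral_eq_integral[OF int]) (auto simp: ennreal_le_iff)
qed

lemma integrable_offdiag:
  assumes "CE T \<mu> \<nu> c v"
  shows "integrable (leb_Icc T) (\<lambda>t. offdiag (v t))"
  using assms linear_offdiag integrable_bounded_linear[of offdiag "leb_Icc T" v]
  by (simp add: CE_def integrable_leb_Icc_iff linear_linear)

lemma CE_weak_form:
  assumes "CE T \<mu> \<nu> c v" "test_fun T \<phi>"
  shows "(\<integral>t. deriv \<phi> t * c t $ x - \<phi> t * divg (offdiag (v t)) x \<partial>leb_Icc T) = 0"
  using assms by (simp add: CE_def integral_leb_Icc divg_offdiag)

text \<open>The bound of \<open>weak_derivative_modulus\<close> sees a curve only through the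
  \<open>L^2\<close> bound on its divergence, and that bound is the same for all
  \<open>k\<close>.\<close>

lemma CE_equicontinuous:
  fixes Q :: "real^'x::finite \<Rightarrow> real^'x^'x"
  assumes Q: "standing Q" and T: "0 < T"
    and CE: "\<And>k::nat. CE T (c k 0) (c k T) (c k) (v k)"
    and act: "\<And>k. ActionInt Q T (c k) (v k) \<le> ennreal C"
    and "0 < e"
  shows "\<exists>d>0. \<forall>k. \<forall>s\<in>{0..T}. \<forall>t\<in>{0..T}. \<bar>s - t\<bar> < d \<longrightarrow> norm (c k s - c k t) < e"
proof -
  obtain W where W: "0 < W" "\<And>\<mu> x y. \<mu> \<in> Prob \<Longrightarrow> x \<noteq> y \<Longrightarrow> wgt Q \<mu> x y \<le> W"
    using wgt_bounded[OF Q] by blast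
  note sq = integral_square_offdiag_le[OF Q CE act W]
  have "\<forall>x. \<exists>B. \<forall>v::real^'x^'x. norm (divg v x) \<le> B * norm v"
    using linear_bounded[OF linear_divg] by blast
  from choice[OF this] obtain B where "\<forall>x. \<forall>v::real^'x^'x. norm (divg v x) \<le> B x * norm v" ..
  then have B: "\<bar>divg v x\<bar> \<le> B x * norm v" for x and v :: "real^'x^'x" by simp
  define K where "K x = (B x)\<^sup>2 * (2 * W * max 0 C)" for x
  define K' where "K' = (\<Sum>x\<in>UNIV. K x)"
  define N where "N = real CARD('x)"
  have K0: "0 \<le> K x" for x using W by (simp add: K_def)
  then have K'0: "0 \<le> K'" by (simp add: K'_def sum_nonneg)
  have N0: "0 < N" by (simp add: N_def)
  have mod: "\<bar>c k s $ x - c k t $ x\<bar> \<le> (\<eta> * K x + \<bar>s - t\<bar> / \<eta>) / 2"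
    if st: "s \<in> {0..T}" "t \<in> {0..T}" and "0 < \<eta>" for k s t x \<eta>
  proof (rule weak_derivative_modulus[where g="\<lambda>t. divg (offdiag (v k t)) x"])
    have "continuous_on {0..T} (c k)" using CE by (simp add: CE_def)
    then show "continuous_on {0..T} (\<lambda>t. c k t $ x)" by (intro continuous_intros)
    show int: "integrable (leb_Icc T) (\<lambda>t. divg (offdiag (v k t)) x)"
      using integrable_bounded_linear[OF _ integrable_offdiag[OF CE]] linear_divg
      by (auto simp: linear_linear)
    have le: "(divg (offdiag (v k t)) x)\<^sup>2 \<le> (B x)\<^sup>2 * (norm (offdiag (v k t)))\<^sup>2" for t
      using power_mono[OF B[of "offdiag (v k t)" x], of 2] by (simp add: power_mult_distrib)
    have int2: "integrable (leb_Icc T) (\<lambda>t. (B x)\<^sup>2 * (norm (offdiag (v k t)))\<^sup>2)"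
      using sq(1) by simp
    show int3: "integrable (leb_Icc T) (\<lambda>t. (divg (offdiag (v k t)) x)\<^sup>2)"
      by (rule Bochner_Integration.integrable_bound[OF int2]) (use int le in auto)
    have "(\<integral>t. (divg (offdiag (v k t)) x)\<^sup>2 \<partial>leb_Icc T) \<le> (B x)\<^sup>2 * (\<integral>t. (norm (offdiag (v k t)))\<^sup>2 \<partial>leb_Icc T)"
      using integral_mono[OF int3 int2] le by simp
    also have "\<dots> \<le> K x" unfolding K_def by (intro mult_left_mono sq(2) zero_le_power2)
    finally show "(\<integral>t. (divg (offdiag (v k t)) x)\<^sup>2 \<partial>leb_Icc T) \<le> K x" .
    show "(\<integral>t. deriv \<phi> t * c k t $ x - \<phi> t * divg (offdiag (v k t)) x \<partial>leb_Icc T) = 0"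
      if "test_fun T \<phi>" for \<phi>
      using CE_weak_form[OF CE that] .
  qed (use T st \<open>0 < \<eta>\<close> in auto)
  \<comment> \<open>\<open>\<eta>\<close> makes \<open>\<eta> * K' < e\<close>, and then
    \<open>d\<close> makes \<open>N * (|s - t| / \<eta>) < e\<close>; half of their sum stays below
    \<open>e\<close>.\<close>
  define \<eta> where "\<eta> = e / (K' + 1)"
  define d where "d = \<eta> * e / N"
  have \<eta>0: "0 < \<eta>" and d0: "0 < d" using \<open>0 < e\<close> K'0 N0 by (auto simp: \<eta>_def d_def)
  have "norm (c k s - c k t) < e" if st: "s \<in> {0..T}" "t \<in> {0..T}" and d: "\<bar>s - t\<bar> < d" for k s t
  proof -
    have "norm (c k s - c k t) \<le> (\<Sum>x\<in>UNIV. \<bar>c k s $ x - c k t $ x\<bar>)"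
      using norm_le_l1_cart[of "c k s - c k t"] by simp
    also have "\<dots> \<le> (\<Sum>x\<in>UNIV. (\<eta> * K x + \<bar>s - t\<bar> / \<eta>) / 2)"
      using mod[OF st \<eta>0] by (intro sum_mono) auto
    also have "\<dots> = (\<eta> * K' + N * (\<bar>s - t\<bar> / \<eta>)) / 2"
      by (simp add: K'_def N_def sum.distrib sum_distrib_left flip: sum_divide_distrib)
    also have "\<eta> * K' < e" using \<open>0 < e\<close> K'0 by (simp add: \<eta>_def field_simps)
    also have "N * (\<bar>s - t\<bar> / \<eta>) < e" using d N0 \<eta>0 by (simp add: d_def field_simps)
    finally show ?thesis by simp
  qed
  with d0 show ?thesis by blast
qed

section \<open>The weak equation as a bounded linear functional\<close>

lemma test_fun_bounded:
  assumes "test_fun T \<phi>"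
  obtains B where "0 \<le> B" "\<forall>t\<in>{0..T}. \<bar>\<phi> t\<bar> \<le> B \<and> \<bar>deriv \<phi> t\<bar> \<le> B"
    "continuous_on {0..T} \<phi>" "continuous_on {0..T} (deriv \<phi>)"
proof -
  obtain D where D: "\<And>t. (\<phi> has_vector_derivative D t) (at t)" "continuous_on UNIV D"
    using assms unfolding test_fun_def C1_differentiable_on_def by auto
  then have der: "(\<phi> has_real_derivative D t) (at t)" for t
    by (simp add: has_real_derivative_iff_has_vector_derivative)
  have "deriv \<phi> = D" using DERIV_imp_deriv[OF der] by auto
  then have c2: "continuous_on {0..T} (deriv \<phi>)"
    using D(2) continuous_on_subset by blast
  have c1: "continuous_on {0..T} \<phi>"
    using DERIV_isCont[OF der] by (intro continuous_at_imp_continuous_on) auto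
  from compact_imp_bounded[OF compact_continuous_image[OF c1 compact_Icc]]
  obtain B1 where B1: "\<forall>y\<in>\<phi> ` {0..T}. norm y \<le> B1" unfolding bounded_iff ..
  from compact_imp_bounded[OF compact_continuous_image[OF c2 compact_Icc]]
  obtain B2 where B2: "\<forall>y\<in>deriv \<phi> ` {0..T}. norm y \<le> B2" unfolding bounded_iff ..
  show thesis
    by (rule that[of "max 0 (max B1 B2)"])
      (use B1 B2 c1 c2 in \<open>auto simp: le_max_iff_disj\<close>)
qed

text \<open>At each time the integrand of the weak equation is linear in the triple of flux, curve
  and weight, with a norm bounded uniformly in time. Hence \<open>L^1\<close> convergence of triples
  is enough to pass to the limit.\<close>

lemma weak_form_bound:
  fixes T :: real and x :: "'x::finite"
  assumes \<phi>: "test_fun T \<phi>"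
  obtains B where
    "\<And>f :: real \<Rightarrow> (real^'x^'x) \<times> (real^'x) \<times> (real^'x^'x). integrable (leb_Icc T) f \<Longrightarrow>
      integrable (leb_Icc T) (\<lambda>t. deriv \<phi> t * fst (snd (f t)) $ x - \<phi> t * divg (fst (f t)) x)"
    "\<And>t (p :: (real^'x^'x) \<times> (real^'x) \<times> (real^'x^'x)). t \<in> {0..T} \<Longrightarrow>
      \<bar>deriv \<phi> t * fst (snd p) $ x - \<phi> t * divg (fst p) x\<bar> \<le> B * norm p"
proof -
  let ?L = "\<lambda>t (p :: (real^'x^'x) \<times> (real^'x) \<times> (real^'x^'x)). deriv \<phi> t * fst (snd p) $ x - \<phi> t * divg (fst p) x"
  obtain B1 where B1: "0 \<le> B1" "\<forall>t\<in>{0..T}. \<bar>\<phi> t\<bar> \<le> B1 \<and> \<bar>deriv \<phi> t\<bar> \<le> B1"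
    "continuous_on {0..T} \<phi>" "continuous_on {0..T} (deriv \<phi>)"
    by (rule test_fun_bounded[OF \<phi>])
  obtain B2 where B2: "0 < B2" "\<And>v::real^'x^'x. norm (divg v x) \<le> B2 * norm v"
    using linear_bounded_pos[OF linear_divg] by blast
  have bound: "\<bar>?L t p\<bar> \<le> (B1 + B1 * B2) * norm p" if "t \<in> {0..T}" for t p
  proof -
    have "norm (fst p) \<le> norm p" "norm (snd p) \<le> norm p" "norm (fst (snd p)) \<le> norm (snd p)"
      using norm_fst_le[of "fst p" "snd p"] norm_snd_le[of "snd p" "fst p"]
        norm_fst_le[of "fst (snd p)" "snd (snd p)"] by auto
    moreover have "\<bar>fst (snd p) $ x\<bar> \<le> norm (fst (snd p))" by (rule component_le_norm_cart)
    moreover have "\<bar>divg (fst p) x\<bar> \<le> B2 * norm (fst p)" using B2(2) by simp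
    moreover have "B2 * norm (fst p) \<le> B2 * norm p" using B2(1) calculation(1) by simp
    ultimately have "\<bar>fst (snd p) $ x\<bar> \<le> norm p" "\<bar>divg (fst p) x\<bar> \<le> B2 * norm p" by linarith+
    then have "\<bar>deriv \<phi> t\<bar> * \<bar>fst (snd p) $ x\<bar> \<le> B1 * norm p" "\<bar>\<phi> t\<bar> * \<bar>divg (fst p) x\<bar> \<le> B1 * (B2 * norm p)"
      using B1 that by (auto intro!: mult_mono)
    moreover have "\<bar>?L t p\<bar> \<le> \<bar>deriv \<phi> t\<bar> * \<bar>fst (snd p) $ x\<bar> + \<bar>\<phi> t\<bar> * \<bar>divg (fst p) x\<bar>"
      by (metis abs_mult abs_triangle_ineq4)
    ultimately show ?thesis by (simp add: algebra_simps)
  qed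
  have int: "integrable (leb_Icc T) (\<lambda>t. ?L t (f t))" if f: "integrable (leb_Icc T) f" for f
  proof (rule Bochner_Integration.integrable_bound)
    show "integrable (leb_Icc T) (\<lambda>t. (B1 + B1 * B2) * norm (f t))" using f by simp
    have \<phi>m: "\<phi> \<in> borel_measurable (leb_Icc T)" "deriv \<phi> \<in> borel_measurable (leb_Icc T)"
      "f \<in> borel_measurable (leb_Icc T)"
      using B1 f by (auto intro: measurable_leb_Icc_continuous)
    have "continuous_on UNIV (\<lambda>v. divg v x)"
      using linear_continuous_on[OF linear_linear[THEN iffD2, OF linear_divg]] .
    then have fm: "(\<lambda>t. divg (fst (f t)) x) \<in> borel_measurable (leb_Icc T)"
      "(\<lambda>t. fst (snd (f t)) $ x) \<in> borel_measurable (leb_Icc T)"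
      using \<phi>m(3) by (auto intro!: borel_measurable_continuous_on[where g=f] continuous_intros
          intro: continuous_on_compose2)
    show "(\<lambda>t. ?L t (f t)) \<in> borel_measurable (leb_Icc T)"
      by (intro borel_measurable_diff borel_measurable_times \<phi>m fm)
    show "AE t in leb_Icc T. norm (?L t (f t)) \<le> norm ((B1 + B1 * B2) * norm (f t))"
    proof (rule AE_I2)
      fix t assume "t \<in> space (leb_Icc T)"
      then show "norm (?L t (f t)) \<le> norm ((B1 + B1 * B2) * norm (f t))"
        using bound[of t "f t"] B1 B2 by (simp add: space_restrict_space abs_mult)
    qed
  qed
  show thesis by (rule that[OF int bound])
qed

theorem theorem4p5:
  fixes Q :: "real^'x::finite \<Rightarrow> real^'x^'x"
    and T C :: real
    and c :: "nat \<Rightarrow> real \<Rightarrow> real^'x"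
    and v :: "nat \<Rightarrow> real \<Rightarrow> real^'x^'x"
  assumes "standing Q"
    and "T > 0"
    and "\<And>k. CE T (c k 0) (c k T) (c k) (v k)"
    and "\<And>k. ActionInt Q T (c k) (v k) \<le> ennreal C"
  shows "\<exists>r c_lim v_lim. strict_mono r \<and>
           uniform_limit {0..T} (\<lambda>k. c (r k)) c_lim sequentially \<and>
           CE T (c_lim 0) (c_lim T) c_lim v_lim \<and>
           ActionInt Q T c_lim v_lim \<le> liminf (\<lambda>k. ActionInt Q T (c (r k)) (v (r k)))"
proof -
  note Q = assms(1) and CE = assms(3) and act = assms(4)
  interpret M: finite_measure "leb_Icc T" by (rule finite_measure_leb_Icc)
  have Prob: "c k t \<in> Prob" if "t \<in> {0..T}" for k t
    using CE[of k] that by (simp add: CE_def)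
  have cont: "continuous_on {0..T} (c k)" for k
    using CE[of k] by (simp add: CE_def)

  obtain r1 c_lim where c_lim: "continuous_on {0..T} c_lim" and r1: "strict_mono (r1 :: nat \<Rightarrow> nat)"
    and conv: "\<And>e. 0 < e \<Longrightarrow> \<exists>N. \<forall>n t. n \<ge> N \<and> t \<in> {0..T} \<longrightarrow> norm (c (r1 n) t - c_lim t) < e"
  proof (rule Arzela_Ascoli[of "{0..T}" c 1])
    show "norm (c k t) \<le> 1" if "t \<in> {0..T}" for k t
      using norm_Prob_le[OF Prob[OF that]] .
    show "\<exists>d>0. \<forall>n y. y \<in> {0..T} \<and> norm (t - y) < d \<longrightarrow> norm (c n t - c n y) < e"
      if t: "t \<in> {0..T}" and e: "0 < e" for t e
      using CE_equicontinuous[where c=c and v=v, OF Q \<open>0 < T\<close> CE act e] t unfolding real_norm_def by blast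
  qed auto
  \<comment> \<open>Averages of a tail are controlled only by the supremum of the actions over that
    tail, which leads to the upper limit. Along a subsequence with convergent actions the upper and
    the lower limit agree.\<close>
  obtain l r2 where r2: "strict_mono (r2 :: nat \<Rightarrow> nat)"
    and l: "((\<lambda>k. ActionInt Q T (c (r1 k)) (v (r1 k))) \<circ> r2) \<longlonglongrightarrow> l"
    using compact_complete_linorder by blast
  define r where "r = r1 \<circ> r2"
  have r: "strict_mono r" unfolding r_def by (rule strict_mono_o[OF r1 r2])
  define A where "A k = ActionInt Q T (c (r k)) (v (r k))" for k
  have Al: "A \<longlonglongrightarrow> l" using l by (simp add: A_def[abs_def] r_def o_def)
  have "uniform_limit {0..T} (\<lambda>k. c (r1 k)) c_lim sequentially"
    using conv unfolding uniform_limit_iff eventually_sequentially dist_norm by blast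
  from filterlim_compose[OF this filterlim_subseq[OF r2]]
  have unif: "uniform_limit {0..T} (\<lambda>k. c (r k)) c_lim sequentially"
    by (simp add: r_def o_def)
  have climit: "(\<lambda>k. c (r k) t) \<longlonglongrightarrow> c_lim t" if "t \<in> {0..T}" for t
    using tendsto_uniform_limitI[OF unif that] .
  have clProb: "c_lim t \<in> Prob" if "t \<in> {0..T}" for t
    using closed_sequentially[OF compact_imp_closed[OF compact_Prob] _ climit[OF that]] Prob[OF that]
    by blast
  have wcont: "continuous_on Prob (wgt_matrix Q)" by (rule continuous_on_wgt_matrix[OF Q])
  have wlimit: "(\<lambda>k. wgt_matrix Q (c (r k) t)) \<longlonglongrightarrow> wgt_matrix Q (c_lim t)" if "t \<in> {0..T}" for t
    using continuous_on_tendsto_compose[OF wcont climit[OF that] clProb[OF that]] Prob[OF that] by simp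

  obtain W where W: "0 < W" "\<And>\<mu> x y. \<mu> \<in> Prob \<Longrightarrow> x \<noteq> y \<Longrightarrow> wgt Q \<mu> x y \<le> W"
    using wgt_bounded[OF Q] by blast
  from compact_imp_bounded[OF compact_continuous_image[OF wcont compact_Prob]]
  obtain B where B: "\<forall>w\<in>wgt_matrix Q ` Prob. norm w \<le> B" unfolding bounded_iff ..
  note sq = integral_square_offdiag_le[OF Q CE act W]

  \<comment> \<open>Averaging fluxes, curves and weights with the same coefficients keeps the weak continuity
    equation and the bound on the jointly convex action.\<close>
  define F where "F k t = (offdiag (v (r k) t), c (r k) t, wgt_matrix Q (c (r k) t))" for k t
  have Fmeas: "F k \<in> borel_measurable (leb_Icc T)" for k
    unfolding F_def[abs_def]
  proof (intro borel_measurable_Pair)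
    show "(\<lambda>t. offdiag (v (r k) t)) \<in> borel_measurable (leb_Icc T)"
      by (rule borel_measurable_integrable[OF integrable_offdiag[OF CE]])
    show "c (r k) \<in> borel_measurable (leb_Icc T)"
      by (rule measurable_leb_Icc_continuous[OF cont])
    show "(\<lambda>t. wgt_matrix Q (c (r k) t)) \<in> borel_measurable (leb_Icc T)"
      using Prob by (intro measurable_leb_Icc_continuous continuous_on_compose2[OF wcont cont]) auto
  qed
  \<comment> \<open>The 1 accounts for the curve, as probability vectors have norm at most 1, and
    \<open>B\<close> for the weights.\<close>
  have Fnorm: "(norm (F k t))\<^sup>2 \<le> (norm (offdiag (v (r k) t)))\<^sup>2 + (1 + B\<^sup>2)" if "t \<in> {0..T}" for k t
  proof -
    have "(norm (c (r k) t))\<^sup>2 \<le> 1\<^sup>2" "(norm (wgt_matrix Q (c (r k) t)))\<^sup>2 \<le> B\<^sup>2"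
      using norm_Prob_le[OF Prob[OF that]] B Prob[OF that] by (intro power_mono; auto)+
    then show ?thesis by (simp add: F_def norm_Pair)
  qed
  have bint: "integrable (leb_Icc T) (\<lambda>t. (norm (offdiag (v (r k) t)))\<^sup>2 + (1 + B\<^sup>2))" for k
    using sq(1) by simp
  have Fsq: "integrable (leb_Icc T) (\<lambda>t. (norm (F k t))\<^sup>2)" for k
  proof (rule Bochner_Integration.integrable_bound[OF bint[of k]])
    show "(\<lambda>t. (norm (F k t))\<^sup>2) \<in> borel_measurable (leb_Icc T)" using Fmeas[of k] by measurable
    show "AE t in leb_Icc T. norm ((norm (F k t))\<^sup>2) \<le> norm ((norm (offdiag (v (r k) t)))\<^sup>2 + (1 + B\<^sup>2))"
    proof (rule AE_I2)
      fix t assume "t \<in> space (leb_Icc T)"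
      then show "norm ((norm (F k t))\<^sup>2) \<le> norm ((norm (offdiag (v (r k) t)))\<^sup>2 + (1 + B\<^sup>2))"
        using Fnorm[of t k] by (simp add: space_restrict_space)
    qed
  qed
  have Fbound: "(\<integral>t. (norm (F k t))\<^sup>2 \<partial>leb_Icc T)
      \<le> 2 * W * max 0 C + (1 + B\<^sup>2) * measure (leb_Icc T) (space (leb_Icc T))" for k
  proof -
    have "(\<integral>t. (norm (F k t))\<^sup>2 \<partial>leb_Icc T)
        \<le> (\<integral>t. (norm (offdiag (v (r k) t)))\<^sup>2 + (1 + B\<^sup>2) \<partial>leb_Icc T)"
      using Fnorm by (intro integral_mono Fsq bint) (auto simp: space_restrict_space)
    also have "\<dots> = (\<integral>t. (norm (offdiag (v (r k) t)))\<^sup>2 \<partial>leb_Icc T)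
        + (1 + B\<^sup>2) * measure (leb_Icc T) (space (leb_Icc T))"
      using sq(1) by (subst Bochner_Integration.integral_add) auto
    finally show ?thesis using sq(2)[of "r k"] by linarith
  qed
  obtain u G where "\<forall>i. u i \<in> mid_hull F i" and G: "integrable (leb_Icc T) G"
    and AElim: "AE t in leb_Icc T. (\<lambda>i. u i t) \<longlonglongrightarrow> G t"
    and L1: "(\<lambda>i. \<integral>t. norm (u i t - G t) \<partial>leb_Icc T) \<longlonglongrightarrow> 0"
    by (rule M.mid_hull_L2_bounded_convergent[OF Fmeas Fsq Fbound])
  then have u: "u i \<in> mid_hull F i" for i by blast
  have hullmeas: "g \<in> borel_measurable (leb_Icc T)" and hullint: "integrable (leb_Icc T) g"
    if "g \<in> mid_hull F n" for g n
    using mid_hull_square_integrable[OF Fmeas Fsq Fbound that] M.integrable_of_square_integrable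
    by auto
  define v_lim where "v_lim t = fst (G t)" for t
  \<comment> \<open>The last two entries of \<open>G\<close> are identified by uniqueness of limits.
    The flux entry has no other description and serves as the definition of the limit flux.\<close>
  have Geq: "AE t in leb_Icc T. G t = (v_lim t, c_lim t, wgt_matrix Q (c_lim t))"
    using AElim AE_space
  proof eventually_elim
    case (elim t)
    then have t: "t \<in> {0..T}" by (simp add: space_restrict_space)
    have lin: "linear (\<lambda>p :: (real^'x^'x) \<times> (real^'x) \<times> (real^'x^'x). snd p)"
      by (rule linearI) auto
    have "(\<lambda>k. snd (F k t)) \<longlonglongrightarrow> (c_lim t, wgt_matrix Q (c_lim t))"
      unfolding F_def using tendsto_Pair[OF climit[OF t] wlimit[OF t]] by simp
    from mid_hull_tendsto[OF lin this u]
    have "(\<lambda>i. snd (u i t)) \<longlonglongrightarrow> (c_lim t, wgt_matrix Q (c_lim t))" .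
    with tendsto_snd[OF elim(1)] have "snd (G t) = (c_lim t, wgt_matrix Q (c_lim t))"
      using LIMSEQ_unique by blast
    then show ?case by (simp add: v_lim_def prod_eq_iff)
  qed

  have CElim: "CE T (c_lim 0) (c_lim T) c_lim v_lim"
    unfolding CE_def
  proof (intro conjI ballI allI impI refl c_lim clProb)
    have vint: "integrable (leb_Icc T) v_lim"
      unfolding v_lim_def[abs_def] by (rule integrable_bounded_linear[OF bounded_linear_fst G])
    then show "set_integrable lborel {0..T} v_lim"
      by (simp add: integrable_leb_Icc_iff)
    fix \<phi> :: "real \<Rightarrow> real" and x :: 'x
    assume \<phi>: "test_fun T \<phi>"
    define L where "L t p = deriv \<phi> t * fst (snd p) $ x - \<phi> t * divg (fst p) x"
      for t and p :: "(real^'x^'x) \<times> (real^'x) \<times> (real^'x^'x)"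
    obtain b where Lint: "\<And>f. integrable (leb_Icc T) f \<Longrightarrow> integrable (leb_Icc T) (\<lambda>t. L t (f t))"
      and Lb: "\<And>t p. t \<in> {0..T} \<Longrightarrow> \<bar>L t p\<bar> \<le> b * norm p"
      using weak_form_bound[OF \<phi>, of x] unfolding L_def by blast
    have Ladd: "L t (p + q) = L t p + L t q" and Lscale: "L t (a *\<^sub>R p) = a * L t p" for t p q a
      unfolding L_def
      by (simp_all add: linear_add[OF linear_divg] linear_cmul[OF linear_divg] algebra_simps)
    have Ldiff: "L t (p - q) = L t p - L t q" for t p q
      using Ladd[of t "p - q" q] by simp
    have zero: "(\<integral>t. L t (g t) \<partial>leb_Icc T) = 0" if "g \<in> mid_hull F n" for g n
      using that
    proof (induction rule: mid_hull.induct)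
      case (base k)
      then show ?case
        using CE_weak_form[OF CE \<phi>, of "r k" x] by (simp add: L_def F_def)
    next
      case (mid g h)
      then show ?case
        using Lint[OF hullint[OF mid.hyps(1)]] Lint[OF hullint[OF mid.hyps(2)]]
        by (simp add: Lscale Ladd)
    qed
    \<comment> \<open>Each average satisfies the weak equation exactly, so up to sign the defect of
      \<open>G\<close> is that of \<open>u i - G\<close>, at most \<open>b\<close> times their
      \<open>L^1\<close> distance.\<close>
    have "norm (\<integral>t. L t (G t) \<partial>leb_Icc T) \<le> b * (\<integral>t. norm (u i t - G t) \<partial>leb_Icc T)" for i
    proof -
      have ui: "integrable (leb_Icc T) (u i)" by (rule hullint[OF u])
      have int: "integrable (leb_Icc T) (\<lambda>t. u i t - G t)" using ui G by auto
      have "(\<integral>t. L t (G t) \<partial>leb_Icc T) = - (\<integral>t. L t (u i t - G t) \<partial>leb_Icc T)"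
        using Lint[OF ui] Lint[OF G] zero[OF u[of i]] by (simp add: Ldiff)
      then have "norm (\<integral>t. L t (G t) \<partial>leb_Icc T) \<le> (\<integral>t. norm (L t (u i t - G t)) \<partial>leb_Icc T)"
        using integral_norm_bound[of "leb_Icc T" "\<lambda>t. L t (u i t - G t)"] by simp
      also have "\<dots> \<le> (\<integral>t. b * norm (u i t - G t) \<partial>leb_Icc T)"
        using Lint[OF int] int Lb by (intro integral_mono) (auto simp: space_restrict_space)
      finally show ?thesis by simp
    qed
    moreover have "(\<lambda>i. b * (\<integral>t. norm (u i t - G t) \<partial>leb_Icc T)) \<longlonglongrightarrow> 0"
      using tendsto_mult_right_zero[OF L1] .
    ultimately have "norm (\<integral>t. L t (G t) \<partial>leb_Icc T) \<le> 0"
      by (intro LIMSEQ_le_const) auto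
    moreover have "(\<integral>t. L t (G t) \<partial>leb_Icc T) = (\<integral>t. deriv \<phi> t * c_lim t $ x - \<phi> t * divg (v_lim t) x \<partial>leb_Icc T)"
    proof (rule integral_cong_AE)
      show "(\<lambda>t. L t (G t)) \<in> borel_measurable (leb_Icc T)"
        using Lint[OF G] by blast
      \<comment> \<open>The integrand with \<open>c_lim\<close> as its curve needs measurability of
        its own. \<open>Lint\<close> supplies it, applied to the triple with 0 in the weight
        entry.\<close>
      have "integrable (leb_Icc T) (\<lambda>t. (v_lim t, c_lim t, 0 :: real^'x^'x))"
      proof (rule Bochner_Integration.integrable_bound)
        show "integrable (leb_Icc T) (\<lambda>t. norm (v_lim t) + norm (c_lim t))"
          using vint integrable_leb_Icc_continuous[OF c_lim] by auto
        show "(\<lambda>t. (v_lim t, c_lim t, 0 :: real^'x^'x)) \<in> borel_measurable (leb_Icc T)"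
          using vint measurable_leb_Icc_continuous[OF c_lim] by (intro borel_measurable_Pair) auto
      qed (auto simp: norm_Pair intro!: AE_I2 sqrt_sum_squares_le_sum)
      from borel_measurable_integrable[OF Lint[OF this]]
      show "(\<lambda>t. deriv \<phi> t * c_lim t $ x - \<phi> t * divg (v_lim t) x) \<in> borel_measurable (leb_Icc T)"
        by (simp add: L_def)
      show "AE t in leb_Icc T. L t (G t) = deriv \<phi> t * c_lim t $ x - \<phi> t * divg (v_lim t) x"
        using Geq by eventually_elim (simp add: L_def)
    qed
    ultimately show "(LINT t:{0..T}|lborel. deriv \<phi> t * c_lim t $ x - \<phi> t * divg (v_lim t) x) = 0"
      by (simp add: integral_leb_Icc)
  qed

  define S where "S n = (SUP k\<in>{n..}. A k)" for n
  define E where "E g = (\<integral>\<^sup>+t. matrix_action (fst (g t)) (snd (snd (g t))) \<partial>leb_Icc T)"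
    for g :: "real \<Rightarrow> (real^'x^'x) \<times> (real^'x) \<times> (real^'x^'x)"
  have meas: "(\<lambda>t. matrix_action (fst (g t)) (snd (snd (g t)))) \<in> borel_measurable (leb_Icc T)"
    if "g \<in> mid_hull F n" for g n
    by (intro borel_measurable_matrix_action
        borel_measurable_continuous_on[where f=fst, OF _ hullmeas[OF that]]
        borel_measurable_continuous_on[where f="\<lambda>p. snd (snd p)", OF _ hullmeas[OF that]])
      (intro continuous_intros)+
  \<comment> \<open>By joint convexity, energies at most \<open>S n\<close> persist under midpoints,
    and the tail of \<open>F\<close> starts with such energies.\<close>
  have ES: "E g \<le> S n" if "g \<in> mid_hull F n" for g n
    using that
  proof (induction rule: mid_hull.induct)
    case (base k)
    have "E (F k) = A k"
      unfolding E_def A_def ActionInt_eq Action_eq_matrix_action F_def[abs_def] by (simp add: matrix_action_offdiag)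
    with base show ?case unfolding S_def by (auto intro: SUP_upper)
  next
    case (mid g h)
    have "E (\<lambda>t. (1/2) *\<^sub>R (g t + h t)) \<le> (\<integral>\<^sup>+t. ennreal (1/2) *
        (matrix_action (fst (g t)) (snd (snd (g t))) + matrix_action (fst (h t)) (snd (snd (h t)))) \<partial>leb_Icc T)"
      unfolding E_def
    proof (rule nn_integral_mono)
      fix t
      show "matrix_action (fst ((1/2) *\<^sub>R (g t + h t))) (snd (snd ((1/2) *\<^sub>R (g t + h t))))
        \<le> ennreal (1/2) * (matrix_action (fst (g t)) (snd (snd (g t))) + matrix_action (fst (h t)) (snd (snd (h t))))"
        using matrix_action_midpoint_le[of "fst (g t)" "fst (h t)"] by (simp only: fst_scaleR snd_scaleR fst_add snd_add)
    qed
    also have "\<dots> = ennreal (1/2) * (E g + E h)"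
      unfolding E_def using meas[OF mid.hyps(1)] meas[OF mid.hyps(2)]
      by (simp only: nn_integral_cmult nn_integral_add borel_measurable_add)
    also have "\<dots> \<le> ennreal (1/2) * (S n + S n)"
      by (intro mult_left_mono add_mono mid.IH) simp
    also have "\<dots> = S n"
    proof -
      have "ennreal (1/2) * 2 = ennreal (1/2 * 2)" by (subst ennreal_mult) simp_all
      then have "ennreal (1/2) * 2 = 1" by simp
      then show ?thesis by (simp only: mult_2[symmetric] mult.assoc[symmetric] mult_1)
    qed
    finally show ?case .
  qed
  \<comment> \<open>Tail suprema decrease to the upper limit, which is \<open>l\<close> since the
    actions converge along \<open>r\<close>.\<close>
  have "decseq S" unfolding S_def[abs_def] decseq_def by (intro allI impI SUP_subset_mono) auto
  then have "S \<longlonglongrightarrow> (INF n. S n)" by (rule LIMSEQ_INF)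
  moreover have "(INF n. S n) = limsup A" by (simp add: S_def limsup_INF_SUP)
  moreover have "limsup A = l" using lim_imp_Limsup[OF _ Al] by simp
  ultimately have Sl: "S \<longlonglongrightarrow> l" by simp
  have "ActionInt Q T c_lim v_lim = E G"
    unfolding ActionInt_eq E_def Action_eq_matrix_action
    by (rule nn_integral_cong_AE, use Geq in eventually_elim) simp
  also have "\<dots> \<le> (\<integral>\<^sup>+t. liminf (\<lambda>i. matrix_action (fst (u i t)) (snd (snd (u i t)))) \<partial>leb_Icc T)"
    unfolding E_def
    by (rule nn_integral_mono_AE, use AElim in eventually_elim)
       (intro matrix_action_lsc tendsto_fst tendsto_snd)
  also have "\<dots> \<le> liminf (\<lambda>i. E (u i))"
    unfolding E_def by (rule nn_integral_liminf) (rule meas[OF u])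
  also have "\<dots> \<le> liminf S"
    using ES[OF u] by (intro Liminf_mono always_eventually) auto
  also have "\<dots> = l" using lim_imp_Liminf[OF _ Sl] by simp
  also have "\<dots> = liminf A" using lim_imp_Liminf[OF _ Al] by simp
  finally show ?thesis
    using r unif CElim unfolding A_def by blast
qed

end
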